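(* Let $X$ and $Y$ be Banach spaces such that the space $\mathcal{K}(X,Y)$ of compact operators is an $M$-ideal in the space $\mathcal{L}(X,Y)$ of bounded operators. If $T \in \mathcal{L}(X,Y)$ is a very smooth point of $\mathcal{L}(X,Y)$, then $T$ attains its norm at a unique (up to a scalar multiple) unit vector $x \in X$, and $T(x)$ is a very smooth point of $Y$.
   Context: A unit vector $x$ of a Banach space $Z$ is a smooth point of $Z$ if there is exactly one $z^* \in Z^*$ with $\|z^*\| = 1 = z^*(x)$. A unit vector $x \in Z$ is a very smooth point of $Z$ if, regarded as an element of $Z^{**}$ under the canonical embedding $Z \subset Z^{**}$, it is a smooth point of $Z^{**}$. A closed subspace $M$ of a Banach space $Z$ is an $M$-ideal in $Z$ if there is a linear projection $P : Z^* \to Z^*$ with $\|P(z^* )\| + \|z^* - P(z^* )\| = \|z^*\|$ for all $z^* \in Z^*$ and $\ker P = M^\perp$. $T$ attains its norm at a unit vector $x$ if $\|T(x)\| = \|T\|$. *)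

theory Defs
  imports "HOL-Analysis.Analysis" "HOL-Library.Function_Algebras"
begin

text \<open>
  The scalar field is \<open>\<real>\<close> or \<open>\<complex>\<close>: by Frobenius' theorem, these are up to isometric isomorphism
  the only instances of the following class.
\<close>

class real_or_complex = real_normed_field + euclidean_space

instance real :: real_or_complex ..
instance complex :: real_or_complex ..

text \<open>
  A Banach space over the scalar field is a type of class \<open>banach\<close>, which supplies addition,
  norm and completeness, together with an explicit scalar multiplication.
\<close>

locale banach_space_over = vector_space scale
  for scale :: "'k::real_or_complex \<Rightarrow> 'a::banach \<Rightarrow> 'a" +
  assumes norm_scale: "norm (scale c x) = norm c * norm x"
    and scale_of_real: "scale (of_real r) x = r *\<^sub>R x"

text \<open>
  Operator spaces and iterated duals depend on the scalar multiplications, which are not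
  determined by types, so they are given by explicit carriers and norms.  Addition is that
  of the type; on functions it is the pointwise addition of \<^theory>\<open>HOL-Library.Function_Algebras\<close>.
\<close>

record ('k, 'v) nspace =
  vcarrier :: "'v set"
  vnorm :: "'v \<Rightarrow> real"
  vscale :: "'k \<Rightarrow> 'v \<Rightarrow> 'v"

definition space_of ::
  "('k::real_or_complex \<Rightarrow> 'a::banach \<Rightarrow> 'a) \<Rightarrow> ('k, 'a) nspace" where
  "space_of s = \<lparr>vcarrier = UNIV, vnorm = norm, vscale = s\<rparr>"

definition bounded_ops ::
  "('k::real_or_complex \<Rightarrow> 'a::banach \<Rightarrow> 'a) \<Rightarrow> ('k \<Rightarrow> 'b::banach \<Rightarrow> 'b) \<Rightarrow> ('k, 'a \<Rightarrow> 'b) nspace" where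
  "bounded_ops sX sY =
     \<lparr>vcarrier = {T. Vector_Spaces.linear sX sY T \<and> bounded_linear T},
      vnorm = onorm,
      vscale = (\<lambda>c T x. sY c (T x))\<rparr>"

definition compact_ops ::
  "('k::real_or_complex \<Rightarrow> 'a::banach \<Rightarrow> 'a) \<Rightarrow> ('k \<Rightarrow> 'b::banach \<Rightarrow> 'b) \<Rightarrow> ('a \<Rightarrow> 'b) set" where
  "compact_ops sX sY = {T \<in> vcarrier (bounded_ops sX sY). compact (closure (T ` cball 0 1))}"

text \<open>
  Functionals are total functions; setting them to \<open>0\<close> off the carrier makes equality of functions
  coincide with equality of functionals.
\<close>

definition dual ::
  "('k::real_or_complex, 'v::ab_group_add) nspace \<Rightarrow> ('k, 'v \<Rightarrow> 'k) nspace" where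
  "dual Z =
     \<lparr>vcarrier = {f.
        (\<forall>x\<in>vcarrier Z. \<forall>y\<in>vcarrier Z. f (x + y) = f x + f y) \<and>
        (\<forall>c. \<forall>x\<in>vcarrier Z. f (vscale Z c x) = c * f x) \<and>
        (\<exists>B. \<forall>x\<in>vcarrier Z. norm (f x) \<le> B * vnorm Z x) \<and>
        (\<forall>x. x \<notin> vcarrier Z \<longrightarrow> f x = 0)},
      vnorm = (\<lambda>f. SUP x\<in>{x \<in> vcarrier Z. vnorm Z x \<le> 1}. norm (f x)),
      vscale = (\<lambda>c f x. c * f x)\<rparr>"

definition canonical_embedding ::
  "('k::real_or_complex, 'v::ab_group_add) nspace \<Rightarrow> 'v \<Rightarrow> ('v \<Rightarrow> 'k) \<Rightarrow> 'k" where
  "canonical_embedding Z x = (\<lambda>f. if f \<in> vcarrier (dual Z) then f x else 0)"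

definition smooth_point ::
  "('k::real_or_complex, 'v::ab_group_add) nspace \<Rightarrow> 'v \<Rightarrow> bool" where
  "smooth_point Z x \<longleftrightarrow> x \<in> vcarrier Z \<and> vnorm Z x = 1 \<and>
     (\<exists>!f. f \<in> vcarrier (dual Z) \<and> vnorm (dual Z) f = 1 \<and> f x = 1)"

definition very_smooth_point ::
  "('k::real_or_complex, 'v::ab_group_add) nspace \<Rightarrow> 'v \<Rightarrow> bool" where
  "very_smooth_point Z x \<longleftrightarrow> x \<in> vcarrier Z \<and> vnorm Z x = 1 \<and>
     smooth_point (dual (dual Z)) (canonical_embedding Z x)"

definition closed_subspace ::
  "('k::real_or_complex, 'v::ab_group_add) nspace \<Rightarrow> 'v set \<Rightarrow> bool" where
  "closed_subspace Z M \<longleftrightarrow> M \<subseteq> vcarrier Z \<and> 0 \<in> M \<and>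
     (\<forall>x\<in>M. \<forall>y\<in>M. x + y \<in> M) \<and> (\<forall>c. \<forall>x\<in>M. vscale Z c x \<in> M) \<and>
     (\<forall>u. \<forall>x\<in>vcarrier Z. (\<forall>n. u n \<in> M) \<and> (\<lambda>n::nat. vnorm Z (u n - x)) \<longlonglongrightarrow> 0 \<longrightarrow> x \<in> M)"

definition annihilator ::
  "('k::real_or_complex, 'v::ab_group_add) nspace \<Rightarrow> 'v set \<Rightarrow> ('v \<Rightarrow> 'k) set" where
  "annihilator Z M = {f \<in> vcarrier (dual Z). \<forall>x\<in>M. f x = 0}"

definition linear_projection ::
  "('k::real_or_complex, 'v::ab_group_add) nspace \<Rightarrow> ('v \<Rightarrow> 'v) \<Rightarrow> bool" where
  "linear_projection Z P \<longleftrightarrow>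
     (\<forall>x\<in>vcarrier Z. P x \<in> vcarrier Z \<and> P (P x) = P x) \<and>
     (\<forall>x\<in>vcarrier Z. \<forall>y\<in>vcarrier Z. P (x + y) = P x + P y) \<and>
     (\<forall>c. \<forall>x\<in>vcarrier Z. P (vscale Z c x) = vscale Z c (P x))"

definition M_ideal ::
  "('k::real_or_complex, 'v::ab_group_add) nspace \<Rightarrow> 'v set \<Rightarrow> bool" where
  "M_ideal Z M \<longleftrightarrow> closed_subspace Z M \<and>
     (\<exists>P. linear_projection (dual Z) P \<and>
        (\<forall>f\<in>vcarrier (dual Z). vnorm (dual Z) (P f) + vnorm (dual Z) (f - P f) = vnorm (dual Z) f) \<and>
        {f \<in> vcarrier (dual Z). P f = 0} = annihilator Z M)"

definition attains_norm_at ::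
  "('a::real_normed_vector \<Rightarrow> 'b::real_normed_vector) \<Rightarrow> 'a \<Rightarrow> bool" where
  "attains_norm_at T x \<longleftrightarrow> norm x = 1 \<and> norm (T x) = onorm T"

end

theory Submission
  imports Defs
begin

text \<open>
  Write \<open>L\<close> for the space of bounded operators, \<open>K\<close> for the compact ones, and \<open>x \<otimes> g\<close> for the
  functional \<open>S \<mapsto> g (S x)\<close> on \<open>L\<close> given by \<open>x \<in> X\<close> and \<open>g \<in> Y\<^sup>*\<close>; for \<open>h \<in> X\<^sup>*\<close> and
  \<open>y \<in> Y\<close> let \<open>h \<otimes> y\<close> be the rank one operator \<open>v \<mapsto> h(v) y\<close>.  By Hahn--Banach there is a functional \<open>f\<close> on \<open>L\<close> with \<open>\<parallel>f\<parallel> = 1 = f T\<close>.  The heart of the matter is that \<open>f\<close> is itself of the form \<open>x\<^sub>0 \<otimes> \<eta>\<close>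
  with \<open>x\<^sub>0\<close> and \<open>\<eta>\<close> in the unit balls (\<open>norming_functional_is_tensor\<close>).  Then \<open>\<eta> (T x\<^sub>0) = 1\<close> forces
  \<open>\<parallel>x\<^sub>0\<parallel> = \<parallel>T x\<^sub>0\<parallel> = 1\<close>, so the norm is attained at \<open>x\<^sub>0\<close>.

  The argument for this runs as follows.  Choose \<open>x\<^sub>n\<close> and \<open>g\<^sub>n\<close> in the unit balls with \<open>g\<^sub>n (T x\<^sub>n) \<longlonglongrightarrow> 1\<close>, and
  take limits along an ultrafilter \<open>G\<close>.  A limit of the evaluations \<open>\<Psi> \<mapsto> \<Psi> (x\<^sub>n \<otimes> g\<^sub>n)\<close> is a functional on
  \<open>L\<^sup>*\<^sup>*\<close> of norm one that takes the value one at \<open>T\<close>; since \<open>T\<close> is very smooth, it is evaluation at \<open>f\<close>.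
  Hence \<open>x\<^sub>n \<otimes> g\<^sub>n\<close> tends to \<open>f\<close> weakly in \<open>L\<^sup>*\<close> and not just pointwise on \<open>L\<close>
  (\<open>very_smooth_weak_convergence\<close>), and this is used twice.

  \<^item> The projection \<open>P\<close> of the M-ideal fixes every \<open>x \<otimes> g\<close>, because such a functional already has its full
    norm on the rank one operators (\<open>M_projection_tensor\<close>).  Weak limits of fixed functionals are
    fixed, so \<open>P f = f\<close>; thus \<open>f\<close> is determined by its restriction to \<open>K\<close>.
  \<^item> Let \<open>\<eta>\<close> be the pointwise limit of \<open>g\<^sub>n\<close>.  On a compact operator \<open>S\<close> the vectors \<open>S x\<^sub>n\<close> converge in
    norm, so \<open>f S = \<eta> (lim S x\<^sub>n)\<close>; in particular \<open>\<eta> \<noteq> 0\<close>, as otherwise \<open>f\<close> would vanish on \<open>K\<close> and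
    \<open>P f = 0\<close>.  Fix \<open>y\<close> with \<open>\<eta> y = 1\<close>.  The map that sends \<open>\<phi> \<in> L\<^sup>*\<close> to the functional
    \<open>h \<mapsto> \<phi> (h \<otimes> y)\<close> on \<open>X\<^sup>*\<close> is weakly continuous and takes multiples of \<open>x\<^sub>n\<close> as values at \<open>x\<^sub>n \<otimes> g\<^sub>n\<close>.
    Its value at \<open>f\<close> therefore lies in the weak, hence norm, closure of \<open>X\<close> in \<open>X\<^sup>*\<^sup>*\<close>, that is, in \<open>X\<close>.
    This yields \<open>x\<^sub>0\<close>, which is the weak limit of \<open>x\<^sub>n\<close>, and then \<open>f = x\<^sub>0 \<otimes> \<eta>\<close> on \<open>K\<close>,
    hence on \<open>L\<close>.

  If \<open>T\<close> also attains its norm at \<open>x'\<close>, then \<open>x' \<otimes> h\<close> is norming for a suitable \<open>h\<close> and so equals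
  \<open>x\<^sub>0 \<otimes> \<eta>\<close>; comparison on rank one operators gives \<open>x' \<in> span x\<^sub>0\<close>.  Finally \<open>Y\<close> is a retract of \<open>L\<close> through
  evaluation at \<open>x\<^sub>0\<close>, a contraction with right inverse \<open>y \<mapsto> k \<otimes> y\<close> where \<open>k x\<^sub>0 = 1\<close>; very smooth
  points pass to such retracts (\<open>very_smooth_point_retract\<close>), so \<open>T x\<^sub>0\<close> is very smooth.
\<close>

section \<open>Ultrafilters\<close>

definition ultrafilter :: "'i filter \<Rightarrow> bool" where
  "ultrafilter G \<longleftrightarrow> G \<noteq> bot \<and> (\<forall>P. eventually P G \<or> eventually (\<lambda>i. \<not> P i) G)"

text \<open>
  By Zorn, there is a minimal proper filter below \<open>F\<close>.  If neither \<open>P\<close> nor its negation held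
  eventually, adding the set where \<open>P\<close> holds would give a smaller one.
\<close>

lemma ultrafilter_below:
  fixes F :: "'i filter"
  assumes "F \<noteq> bot"
  obtains G where "ultrafilter G" "G \<le> F"
proof -
  let ?A = "{G. G \<noteq> bot \<and> G \<le> F}"
  let ?r = "relation_of (\<lambda>G H. H \<le> G) ?A"
  have "\<exists>m\<in>?A. \<forall>G\<in>?A. G \<le> m \<longrightarrow> G = m"
  proof (rule predicate_Zorn)
    show "partial_order_on ?A ?r"
      by (rule partial_order_on_relation_ofI) auto
    fix C assume C: "C \<in> Chains ?r"
    show "\<exists>u\<in>?A. \<forall>a\<in>C. u \<le> a"
    proof (cases "C = {}")
      case True
      with assms show ?thesis by auto
    next
      case False
      have CA: "C \<subseteq> ?A" and tot: "\<And>G H. G \<in> C \<Longrightarrow> H \<in> C \<Longrightarrow> G \<le> H \<or> H \<le> G"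
        using C by (auto simp: Chains_def relation_of_def)
      have base: "\<exists>x\<in>C. x \<le> inf G H" if "G \<in> C" "H \<in> C" for G H
        using tot[OF that] that by (auto simp: inf_absorb1 inf_absorb2)
      have "Inf C \<noteq> bot"
      proof
        assume "Inf C = bot"
        then have "eventually (\<lambda>_. False) (Inf C)" by simp
        then obtain G where "G \<in> C" "eventually (\<lambda>_. False) G"
          using eventually_Inf_base[OF False base] by blast
        with CA show False by (auto simp: eventually_False)
      qed
      moreover have "Inf C \<le> F"
      proof -
        obtain G where "G \<in> C" using False by auto
        then show ?thesis using CA by (intro Inf_lower2[of G]) auto
      qed
      ultimately show ?thesis
        by (intro bexI[of _ "Inf C"]) (auto intro: Inf_lower)
    qed
  qed
  then obtain G where G: "G \<noteq> bot" "G \<le> F"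
    and max: "\<And>H. H \<noteq> bot \<Longrightarrow> H \<le> F \<Longrightarrow> H \<le> G \<Longrightarrow> H = G" by auto
  have "eventually P G" if "\<not> eventually (\<lambda>i. \<not> P i) G" for P
  proof -
    let ?H = "inf G (principal {i. P i})"
    have "?H \<noteq> bot"
      using that by (simp add: trivial_limit_def eventually_inf_principal)
    then have "?H = G"
      using G by (intro max) (auto intro: le_infI1)
    then have "G \<le> principal {i. P i}" by (metis inf_le2)
    then show ?thesis by (simp add: le_principal)
  qed
  then show ?thesis
    using that[of G] G by (auto simp: ultrafilter_def)
qed

text \<open>
  Compactness provides a cluster point, and along an ultrafilter cluster points are limits.  No
  subsequences have to be chosen, so one filter serves all sequences and spaces at once.
\<close>

lemma ultrafilter_tendsto_compact:
  fixes s :: "'i \<Rightarrow> 'a::topological_space"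
  assumes G: "ultrafilter G" and C: "compact C" and s: "\<And>i. s i \<in> C"
  obtains l where "l \<in> C" "(s \<longlongrightarrow> l) G"
proof -
  have "filtermap s G \<noteq> bot" "filtermap s G \<le> principal C"
    using G s by (auto simp: ultrafilter_def filtermap_bot_iff le_principal eventually_filtermap)
  with C obtain l where l: "l \<in> C" "inf (nhds l) (filtermap s G) \<noteq> bot"
    unfolding compact_filter by (auto simp: le_principal)
  have "eventually (\<lambda>i. s i \<in> U) G" if "open U" "l \<in> U" for U
  proof (rule ccontr)
    assume "\<not> eventually (\<lambda>i. s i \<in> U) G"
    then have "eventually (\<lambda>y. y \<notin> U) (filtermap s G)"
      using G by (auto simp: ultrafilter_def eventually_filtermap)
    moreover have "eventually (\<lambda>y. y \<in> U) (nhds l)"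
      using that by (rule eventually_nhds_in_open)
    ultimately have "eventually (\<lambda>_. False) (inf (nhds l) (filtermap s G))"
      by (auto simp: eventually_inf)
    with l show False by (simp add: trivial_limit_def)
  qed
  with l that show ?thesis by (auto simp: tendsto_def)
qed

section \<open>Functionals of the scalar field\<close>

lemma inner_one_one: "inner (1::'k::real_or_complex) 1 = 1"
  by (metis norm_eq_1 norm_one)

text \<open>
  The form \<open>(c, a) \<mapsto> inner (c * a) 1\<close>, which for \<open>\<complex>\<close> is the real part of \<open>c * a\<close>, is nondegenerate
  because every nonzero \<open>a\<close> has an inverse.  In finite dimension it therefore represents all
  real-linear functionals.  This allows real functionals to be made \<open>'k\<close>-linear without
  distinguishing the real case from the complex one.
\<close>

lemma scalar_functional_representation:
  fixes g :: "'k::real_or_complex \<Rightarrow> real"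
  assumes "linear g"
  obtains a where "\<And>c. g c = inner (c * a) 1"
proof -
  define W where "W a = adjoint (\<lambda>c::'k. c * a) 1" for a
  have W: "inner c (W a) = inner (c * a) 1" for a c
    unfolding W_def by (intro adjoint_works linearI) (auto simp: algebra_simps)
  have "W (a + b) = W a + W b" "W (r *\<^sub>R a) = r *\<^sub>R W a" for a b r
    by (auto simp: W inner_add_right inner_add_left algebra_simps vector_eq_ldot[symmetric])
  then have lin: "linear W" by (intro linearI)
  have "a = 0" if "W a = 0" for a
  proof (rule ccontr)
    assume "a \<noteq> 0"
    then have "inner (inverse a) (W a) = 1"
      by (simp add: W inner_one_one)
    with that show False by simp
  qed
  then have "inj W" using lin by (simp add: linear_injective_0)
  then have "surj W" by (rule linear_inj_imp_surj[OF lin])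
  then obtain a where "W a = adjoint g 1" by (metis surjD)
  then have "g c = inner (c * a) 1" for c
    using W[of c a] adjoint_works[OF assms, of c 1] by simp
  then show ?thesis by (rule that)
qed

section \<open>Normed spaces on an explicit carrier\<close>

text \<open>
  All that the duality theory below requires of \<open>Z\<close>; it is inherited by duals, so it applies to
  biduals and third duals too.
\<close>

locale normed_nspace =
  fixes Z :: "('k::real_or_complex, 'v::ab_group_add) nspace"
  assumes zero_mem [simp]: "0 \<in> vcarrier Z"
    and add_mem [simp]: "x \<in> vcarrier Z \<Longrightarrow> y \<in> vcarrier Z \<Longrightarrow> x + y \<in> vcarrier Z"
    and scale_mem [simp]: "x \<in> vcarrier Z \<Longrightarrow> vscale Z c x \<in> vcarrier Z"
    and scale_one: "x \<in> vcarrier Z \<Longrightarrow> vscale Z 1 x = x"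
    and scale_scale: "x \<in> vcarrier Z \<Longrightarrow> vscale Z c (vscale Z d x) = vscale Z (c * d) x"
    and scale_left_distrib: "x \<in> vcarrier Z \<Longrightarrow> vscale Z (c + d) x = vscale Z c x + vscale Z d x"
    and scale_right_distrib: "x \<in> vcarrier Z \<Longrightarrow> y \<in> vcarrier Z \<Longrightarrow>
      vscale Z c (x + y) = vscale Z c x + vscale Z c y"
    and norm_triangle: "x \<in> vcarrier Z \<Longrightarrow> y \<in> vcarrier Z \<Longrightarrow> vnorm Z (x + y) \<le> vnorm Z x + vnorm Z y"
    and norm_scale: "x \<in> vcarrier Z \<Longrightarrow> vnorm Z (vscale Z c x) = norm c * vnorm Z x"
    and norm_eq_zero: "x \<in> vcarrier Z \<Longrightarrow> vnorm Z x = 0 \<Longrightarrow> x = 0"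
begin

lemma scale_zero_left: assumes "x \<in> vcarrier Z" shows "vscale Z 0 x = 0"
  using scale_left_distrib[OF assms, of 0 0] by simp

lemma scale_minus_one: assumes "x \<in> vcarrier Z" shows "vscale Z (-1) x = - x"
proof -
  have "x + vscale Z (-1) x = 0"
    using scale_left_distrib[OF assms, of 1 "-1"] scale_zero_left[OF assms] scale_one[OF assms] by simp
  then show ?thesis by (simp add: add_eq_0_iff)
qed

lemma minus_mem [simp]: "x \<in> vcarrier Z \<Longrightarrow> - x \<in> vcarrier Z"
  using scale_minus_one scale_mem by metis

lemma diff_mem [simp]: "x \<in> vcarrier Z \<Longrightarrow> y \<in> vcarrier Z \<Longrightarrow> x - y \<in> vcarrier Z"
  using add_mem[of x "-y"] by simp

lemma norm_zero [simp]: "vnorm Z 0 = 0"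
  using norm_scale[of 0 0] scale_zero_left[of 0] by simp

lemma norm_minus: "x \<in> vcarrier Z \<Longrightarrow> vnorm Z (- x) = vnorm Z x"
  using norm_scale[of x "-1"] by (simp add: scale_minus_one)

lemma norm_nonneg: assumes "x \<in> vcarrier Z" shows "0 \<le> vnorm Z x"
  using norm_triangle[of x "-x"] norm_minus[OF assms] assms by simp

section \<open>The Hahn--Banach theorem\<close>

text \<open>
  Homogeneity is only demanded as an inequality, which is easier to establish for infima; equality
  follows by scaling back.
\<close>

definition sublinear :: "('v \<Rightarrow> real) \<Rightarrow> bool" where
  "sublinear q \<longleftrightarrow>
    (\<forall>x\<in>vcarrier Z. \<forall>y\<in>vcarrier Z. q (x + y) \<le> q x + q y) \<and>
    (\<forall>r\<ge>0. \<forall>x\<in>vcarrier Z. q (vscale Z (of_real r) x) \<le> r * q x)"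

lemma sublinearD:
  assumes "sublinear q" and "x \<in> vcarrier Z"
  shows sublinear_add: "y \<in> vcarrier Z \<Longrightarrow> q (x + y) \<le> q x + q y"
    and sublinear_scale: "0 \<le> r \<Longrightarrow> q (vscale Z (of_real r) x) = r * q x"
    and sublinear_zero: "q 0 = 0"
    and sublinear_minus: "0 \<le> q x + q (- x)"
proof -
  show add: "y \<in> vcarrier Z \<Longrightarrow> q (x + y) \<le> q x + q y" for y
    using assms by (auto simp: sublinear_def)
  have sc: "q (vscale Z (of_real r) x) \<le> r * q x" if "0 \<le> r" "x \<in> vcarrier Z" for r x
    using that assms by (auto simp: sublinear_def)
  have "q (0 + 0) \<le> q 0 + q 0"
    using assms zero_mem unfolding sublinear_def by blast
  then show zero: "q 0 = 0"
    using sc[of 0 0] scale_zero_left[of 0] by simp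
  then show "0 \<le> q x + q (- x)" using add[of "-x"] assms by simp
  show "q (vscale Z (of_real r) x) = r * q x" if "0 \<le> r"
  proof (cases "r = 0")
    case True
    then show ?thesis using zero scale_zero_left[OF assms(2)] by simp
  next
    case False
    have "q x = q (vscale Z (of_real (inverse r)) (vscale Z (of_real r) x))"
      using False assms by (simp add: scale_scale scale_one flip: of_real_mult)
    also have "\<dots> \<le> inverse r * q (vscale Z (of_real r) x)"
      using that assms by (intro sc) auto
    finally show ?thesis
      using sc[of r x] that False assms by (auto simp: field_simps)
  qed
qed

text \<open>
  The largest sublinear functional below \<open>q\<close> with \<open>tilt q a (- a) \<le> - q a\<close>.  Passing from \<open>q\<close> to it
  enforces equality in \<open>- q (- a) \<le> q a\<close>, that is, linearity in the direction \<open>a\<close>.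
\<close>

definition tilt :: "('v \<Rightarrow> real) \<Rightarrow> 'v \<Rightarrow> 'v \<Rightarrow> real" where
  "tilt q a x = (INF t\<in>{0..}. q (x + vscale Z (of_real t) a) - t * q a)"

lemma tilt_bdd:
  assumes q: "sublinear q" and a: "a \<in> vcarrier Z" and x: "x \<in> vcarrier Z" and t: "0 \<le> t"
  shows "- q (- x) \<le> q (x + vscale Z (of_real t) a) - t * q a"
proof -
  have "q (vscale Z (of_real t) a) \<le> q (x + vscale Z (of_real t) a) + q (- x)"
    using sublinear_add[OF q, of "x + vscale Z (of_real t) a" "- x"] a x by simp
  then show ?thesis using sublinear_scale[OF q a t] by simp
qed

lemma tilt_le:
  assumes "sublinear q" and "a \<in> vcarrier Z" and "x \<in> vcarrier Z" and "0 \<le> t"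
  shows "tilt q a x \<le> q (x + vscale Z (of_real t) a) - t * q a"
proof -
  have "bdd_below ((\<lambda>t. q (x + vscale Z (of_real t) a) - t * q a) ` {0..})"
    using tilt_bdd[OF assms(1-3)] by (intro bdd_belowI2) auto
  then show ?thesis
    using assms unfolding tilt_def by (auto intro: cINF_lower)
qed

lemma tilt_greatest:
  assumes "\<And>t. 0 \<le> t \<Longrightarrow> m \<le> q (x + vscale Z (of_real t) a) - t * q a"
  shows "m \<le> tilt q a x"
  using assms unfolding tilt_def by (auto intro!: cINF_greatest)

lemma sublinear_tilt:
  assumes q: "sublinear q" and a: "a \<in> vcarrier Z"
  shows "sublinear (tilt q a)"
  unfolding sublinear_def
proof (intro conjI ballI allI impI)
  fix x y assume x: "x \<in> vcarrier Z" and y: "y \<in> vcarrier Z"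
  have *: "tilt q a (x + y) \<le> (q (x + vscale Z (of_real t) a) - t * q a)
      + (q (y + vscale Z (of_real s) a) - s * q a)" if "0 \<le> t" "0 \<le> s" for t s
  proof -
    have "tilt q a (x + y) \<le> q (x + y + vscale Z (of_real (t + s)) a) - (t + s) * q a"
      using that x y a q by (intro tilt_le) auto
    also have "x + y + vscale Z (of_real (t + s)) a
        = (x + vscale Z (of_real t) a) + (y + vscale Z (of_real s) a)"
      using a by (simp add: scale_left_distrib algebra_simps)
    also have "q \<dots> \<le> q (x + vscale Z (of_real t) a) + q (y + vscale Z (of_real s) a)"
      using x y a by (intro sublinear_add[OF q]) auto
    finally show ?thesis by (simp add: algebra_simps)
  qed
  have "tilt q a (x + y) - (q (x + vscale Z (of_real t) a) - t * q a) \<le> tilt q a y" if "0 \<le> t" for t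
    by (rule tilt_greatest) (use *[OF that] in \<open>simp add: algebra_simps\<close>)
  then have "tilt q a (x + y) - tilt q a y \<le> tilt q a x"
    by (intro tilt_greatest) (simp add: algebra_simps)
  then show "tilt q a (x + y) \<le> tilt q a x + tilt q a y" by simp
next
  fix r :: real and x assume r: "0 \<le> r" and x: "x \<in> vcarrier Z"
  show "tilt q a (vscale Z (of_real r) x) \<le> r * tilt q a x"
  proof (cases "r = 0")
    case True
    have "tilt q a 0 \<le> 0"
      using tilt_le[OF q a zero_mem, of 0] scale_zero_left[OF a] sublinear_zero[OF q a] by simp
    then show ?thesis using True scale_zero_left[OF x] by simp
  next
    case False
    have "tilt q a (vscale Z (of_real r) x) / r \<le> tilt q a x"
    proof (rule tilt_greatest)
      fix t :: real assume t: "0 \<le> t"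
      have "tilt q a (vscale Z (of_real r) x)
          \<le> q (vscale Z (of_real r) x + vscale Z (of_real (r * t)) a) - (r * t) * q a"
        using r t x a q by (intro tilt_le) auto
      also have "vscale Z (of_real r) x + vscale Z (of_real (r * t)) a
          = vscale Z (of_real r) (x + vscale Z (of_real t) a)"
        using x a by (simp add: scale_right_distrib scale_scale)
      also have "q \<dots> = r * q (x + vscale Z (of_real t) a)"
        using x a r by (intro sublinear_scale[OF q]) auto
      finally show "tilt q a (vscale Z (of_real r) x) / r \<le> q (x + vscale Z (of_real t) a) - t * q a"
        using r False by (simp add: field_simps)
    qed
    then show ?thesis using r False by (simp add: field_simps)
  qed
qed

lemma tilt_le_self: "sublinear q \<Longrightarrow> a \<in> vcarrier Z \<Longrightarrow> x \<in> vcarrier Z \<Longrightarrow> tilt q a x \<le> q x"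
  using tilt_le[of q a x 0] by (simp add: scale_zero_left)

lemma tilt_minus: "sublinear q \<Longrightarrow> a \<in> vcarrier Z \<Longrightarrow> tilt q a (- a) \<le> - q a"
  using tilt_le[of q a "- a" 1] by (simp add: scale_one sublinear_zero)

text \<open>
  Zorn's lemma: the pointwise infimum of a chain is again sublinear, since any two members of the
  chain can be replaced by the smaller one.  Functions are normalised to \<open>0\<close> off the carrier, so
  that the order of total functions compares them on the carrier only.
\<close>

lemma sublinear_minimal:
  assumes p: "sublinear p"
  obtains q where "sublinear q" "\<And>x. x \<in> vcarrier Z \<Longrightarrow> q x \<le> p x"
    "\<And>q' x. sublinear q' \<Longrightarrow> (\<And>x. x \<in> vcarrier Z \<Longrightarrow> q' x \<le> q x) \<Longrightarrow> x \<in> vcarrier Z \<Longrightarrow> q' x = q x"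
proof -
  let ?V = "vcarrier Z"
  let ?A = "{q. sublinear q \<and> (\<forall>x\<in>?V. q x \<le> p x) \<and> (\<forall>x. x \<notin> ?V \<longrightarrow> q x = 0)}"
  define cut where "cut = (\<lambda>(q :: 'v \<Rightarrow> real) x. if x \<in> ?V then q x else 0)"
  have cut: "sublinear (cut q)" if "sublinear q" for q
    using that by (auto simp: cut_def sublinear_def)
  let ?r = "relation_of (\<lambda>q q'. q' \<le> q) ?A"
  have "\<exists>m\<in>?A. \<forall>q\<in>?A. q \<le> m \<longrightarrow> q = m"
  proof (rule predicate_Zorn)
    show "partial_order_on ?A ?r"
      by (rule partial_order_on_relation_ofI) auto
    fix C assume C: "C \<in> Chains ?r"
    show "\<exists>u\<in>?A. \<forall>q\<in>C. u \<le> q"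
    proof (cases "C = {}")
      case True
      have "cut p \<in> ?A" using cut[OF p] by (auto simp: cut_def)
      then show ?thesis using True by blast
    next
      case False
      have CA: "\<And>q. q \<in> C \<Longrightarrow> q \<in> ?A" and tot: "\<And>q q'. q \<in> C \<Longrightarrow> q' \<in> C \<Longrightarrow> q \<le> q' \<or> q' \<le> q"
        using C by (auto simp: Chains_def relation_of_def)
      define m where "m x = (INF q\<in>C. q x)" for x
      have bdd: "bdd_below ((\<lambda>q. q x) ` C)" for x
      proof (cases "x \<in> ?V")
        case True
        have "- p (- x) \<le> q x" if "q \<in> C" for q
        proof -
          have "q (- x) \<le> p (- x)" "0 \<le> q x + q (- x)"
            using CA[OF that] True sublinear_minus[of q x] by auto
          then show ?thesis by simp
        qed
        then show ?thesis by (intro bdd_belowI2)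
      next
        case False
        then have "q x = 0" if "q \<in> C" for q using CA[OF that] by blast
        then show ?thesis by (intro bdd_belowI2[where m = 0]) (metis order_refl)
      qed
      have le: "m x \<le> q x" if "q \<in> C" for q x
        unfolding m_def using bdd that by (rule cINF_lower)
      have ge: "b \<le> m x" if "\<And>q. q \<in> C \<Longrightarrow> b \<le> q x" for b x
        unfolding m_def using False that by (rule cINF_greatest)
      have "sublinear m"
        unfolding sublinear_def
      proof (intro conjI ballI allI impI)
        fix x y assume xy: "x \<in> ?V" "y \<in> ?V"
        have *: "m (x + y) \<le> q x + q' y" if "q \<in> C" "q' \<in> C" for q q'
          using tot[OF that]
        proof
          assume h: "q \<le> q'"
          have "m (x + y) \<le> q (x + y)" using that by (intro le)
          also have "\<dots> \<le> q x + q y" using CA[OF that(1)] xy by (auto intro: sublinear_add)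
          finally show ?thesis using h by (auto simp: le_fun_def intro: order_trans)
        next
          assume h: "q' \<le> q"
          have "m (x + y) \<le> q' (x + y)" using that by (intro le)
          also have "\<dots> \<le> q' x + q' y" using CA[OF that(2)] xy by (auto intro: sublinear_add)
          finally show ?thesis using h by (auto simp: le_fun_def intro: order_trans)
        qed
        have "m (x + y) - q x \<le> m y" if "q \<in> C" for q
          by (rule ge) (use *[OF that] in \<open>simp add: algebra_simps\<close>)
        then have "m (x + y) - m y \<le> m x"
          by (intro ge) (simp add: algebra_simps)
        then show "m (x + y) \<le> m x + m y" by simp
      next
        fix r :: real and x assume r: "0 \<le> r" and x: "x \<in> ?V"
        have sc: "m (vscale Z (of_real r) x) \<le> r * q x" if "q \<in> C" for q
        proof -
          have "q (vscale Z (of_real r) x) = r * q x"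
            using CA[OF that] x r by (intro sublinear_scale) auto
          then show ?thesis using le[OF that, of "vscale Z (of_real r) x"] by simp
        qed
        show "m (vscale Z (of_real r) x) \<le> r * m x"
        proof (cases "r = 0")
          case True
          then show ?thesis using sc False by auto
        next
          case False
          then have "m (vscale Z (of_real r) x) / r \<le> m x"
            using sc r by (intro ge) (simp add: field_simps)
          then show ?thesis using r False by (simp add: field_simps)
        qed
      qed
      moreover obtain q where "q \<in> C" using False by auto
      then have "m x \<le> p x" if "x \<in> ?V" for x
        using le[of q x] CA[of q] that by (auto intro: order_trans)
      moreover have "m x = 0" if "x \<notin> ?V" for x
        proof (rule antisym)
        have q0: "q x = 0" if "q \<in> C" for q using CA[OF that] \<open>x \<notin> ?V\<close> by blast
        then show "0 \<le> m x" by (intro ge) (metis order_refl)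
        show "m x \<le> 0" using le[OF \<open>q \<in> C\<close>, of x] q0[OF \<open>q \<in> C\<close>] by simp
      qed
      ultimately show ?thesis using le by (intro bexI[of _ m]) (auto simp: le_fun_def)
    qed
  qed
  then obtain q where q: "q \<in> ?A" and min: "\<And>q'. q' \<in> ?A \<Longrightarrow> q' \<le> q \<Longrightarrow> q' = q" by auto
  show ?thesis
  proof (rule that)
    show "sublinear q" "\<And>x. x \<in> ?V \<Longrightarrow> q x \<le> p x" using q by auto
    fix q' x assume q': "sublinear q'" "\<And>x. x \<in> ?V \<Longrightarrow> q' x \<le> q x" and x: "x \<in> ?V"
    have "cut q' \<in> ?A" "cut q' \<le> q"
      using q q' cut[OF q'(1)] by (auto simp: cut_def le_fun_def intro: order_trans)
    then show "q' x = q x" using min[of "cut q'"] x by (auto simp: cut_def)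
  qed
qed

text \<open>
  A minimal sublinear functional \<open>u\<close> coincides with each of its tilts and is therefore odd, hence
  linear.  Taking \<open>u\<close> below the tilt of \<open>p\<close> at \<open>a\<close> makes \<open>u (- a) \<le> - p a\<close>, which is the prescribed
  value at \<open>a\<close>.
\<close>

lemma real_hahn_banach:
  assumes p: "sublinear p" and a: "a \<in> vcarrier Z"
  obtains u where "\<And>x. x \<in> vcarrier Z \<Longrightarrow> u x \<le> p x" "u a = p a"
    "\<And>x y. x \<in> vcarrier Z \<Longrightarrow> y \<in> vcarrier Z \<Longrightarrow> u (x + y) = u x + u y"
    "\<And>r x. x \<in> vcarrier Z \<Longrightarrow> u (vscale Z (of_real r) x) = r * u x"
proof -
  obtain u where u: "sublinear u" "\<And>x. x \<in> vcarrier Z \<Longrightarrow> u x \<le> tilt p a x"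
    and min: "\<And>q' x. sublinear q' \<Longrightarrow> (\<And>x. x \<in> vcarrier Z \<Longrightarrow> q' x \<le> u x)
      \<Longrightarrow> x \<in> vcarrier Z \<Longrightarrow> q' x = u x"
    using sublinear_minimal[OF sublinear_tilt[OF p a]] by blast
  have le: "u x \<le> p x" if "x \<in> vcarrier Z" for x
    using u(2)[OF that] tilt_le_self[OF p a that] by simp
  have neg: "u (- x) = - u x" if "x \<in> vcarrier Z" for x
  proof -
    have "tilt u x (- x) = u (- x)"
      using that u(1) by (intro min sublinear_tilt tilt_le_self) auto
    then show ?thesis
      using tilt_minus[OF u(1) that] sublinear_minus[OF u(1) that] by simp
  qed
  have "u (- a) \<le> - p a"
    using u(2)[of "- a"] tilt_minus[OF p a] a by simp
  then have eq: "u a = p a" using neg[OF a] le[OF a] by simp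
  have add: "u (x + y) = u x + u y" if "x \<in> vcarrier Z" "y \<in> vcarrier Z" for x y
  proof -
    have "u x \<le> u (x + y) + u (- y)"
      using sublinear_add[OF u(1), of "x + y" "- y"] that by simp
    then show ?thesis
      using neg[OF that(2)] sublinear_add[OF u(1) that] by simp
  qed
  have "u (vscale Z (of_real r) x) = r * u x" if x: "x \<in> vcarrier Z" for r x
  proof (cases "0 \<le> r")
    case True
    then show ?thesis by (intro sublinear_scale[OF u(1) x])
  next
    case False
    have "vscale Z (of_real r) x = - vscale Z (of_real (- r)) x"
      using x scale_scale[of x "-1" "of_real (- r)"] scale_minus_one[of "vscale Z (of_real (- r)) x"]
      by simp
    then show ?thesis
      using neg[of "vscale Z (of_real (- r)) x"] sublinear_scale[OF u(1) x, of "- r"] False x by simp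
  qed
  with le eq add that show ?thesis by blast
qed

text \<open>
  The real functional \<open>u\<close> dominated by \<open>p\<close> is the real part of a unique \<open>'k\<close>-linear \<open>f\<close>: for each \<open>x\<close>,
  the scalar \<open>f x\<close> represents \<open>c \<mapsto> u (c x)\<close>.  Rotating \<open>f x\<close> onto the positive axis turns \<open>u \<le> p\<close>
  into a bound on \<open>norm (f x)\<close>.
\<close>

lemma hahn_banach:
  assumes p_add: "\<And>x y. x \<in> vcarrier Z \<Longrightarrow> y \<in> vcarrier Z \<Longrightarrow> p (x + y) \<le> p x + p y"
    and p_scale: "\<And>c x. x \<in> vcarrier Z \<Longrightarrow> p (vscale Z c x) \<le> norm c * p x"
    and p_le: "\<And>x. x \<in> vcarrier Z \<Longrightarrow> p x \<le> vnorm Z x"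
    and a: "a \<in> vcarrier Z"
  obtains f where "f \<in> vcarrier (dual Z)" "\<And>x. x \<in> vcarrier Z \<Longrightarrow> norm (f x) \<le> p x"
    "f a = of_real (p a)"
proof -
  have "sublinear p"
    unfolding sublinear_def
  proof (intro conjI ballI allI impI)
    show "p (vscale Z (of_real r) x) \<le> r * p x" if "0 \<le> r" "x \<in> vcarrier Z" for r x
      using p_scale[OF that(2), of "of_real r"] that(1) by simp
  qed (rule p_add)
  then obtain u where u_le: "\<And>x. x \<in> vcarrier Z \<Longrightarrow> u x \<le> p x" and u_a: "u a = p a"
    and u_add: "\<And>x y. x \<in> vcarrier Z \<Longrightarrow> y \<in> vcarrier Z \<Longrightarrow> u (x + y) = u x + u y"
    and u_scale: "\<And>r x. x \<in> vcarrier Z \<Longrightarrow> u (vscale Z (of_real r) x) = r * u x"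
    using real_hahn_banach[OF _ a] by metis
  have "\<exists>b. \<forall>c. u (vscale Z c x) = inner (c * b) 1" if x: "x \<in> vcarrier Z" for x
  proof -
    have "linear (\<lambda>c. u (vscale Z c x))"
      using x u_scale[of "vscale Z _ x"]
      by (intro linearI) (auto simp: scale_left_distrib u_add scale_scale scaleR_conv_of_real)
    from scalar_functional_representation[OF this] show ?thesis by metis
  qed
  then obtain g where g: "\<And>c x. x \<in> vcarrier Z \<Longrightarrow> u (vscale Z c x) = inner (c * g x) 1"
    by metis
  define f where "f x = (if x \<in> vcarrier Z then g x else 0)" for x
  have f: "u (vscale Z c x) = inner (c * f x) 1" if "x \<in> vcarrier Z" for c x
    using g that by (simp add: f_def)
  have ext: "b = b'" if "\<And>c::'k. inner (c * b) 1 = inner (c * b') 1" for b b'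
  proof (rule ccontr)
    assume "b \<noteq> b'"
    then have "inner (inverse (b - b') * b) 1 - inner (inverse (b - b') * b') 1 = (1::real)"
      by (simp flip: inner_diff_left right_diff_distrib add: inner_one_one)
    with that[of "inverse (b - b')"] show False by simp
  qed
  have f_norm: "norm (f x) \<le> p x" if x: "x \<in> vcarrier Z" for x
  proof (cases "f x = 0")
    case True
    have "0 \<le> p x"
      using p_add[of 0 0] p_add[of x "- x"] p_scale[OF x, of "-1"] x
      by (simp add: scale_minus_one)
    then show ?thesis using True by simp
  next
    case False
    \<comment> \<open>the unimodular scalar that rotates \<open>f x\<close> to \<open>norm (f x)\<close>\<close>
    define c where "c = of_real (norm (f x)) / f x"
    have "norm (f x) = inner (c * f x) 1"
      proof -
      have "c * f x = norm (f x) *\<^sub>R 1" using False by (simp add: c_def scaleR_conv_of_real)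
      then show ?thesis by (simp add: inner_one_one)
    qed
    also have "\<dots> = u (vscale Z c x)" using f[OF x] by simp
    also have "\<dots> \<le> p x"
      using u_le[of "vscale Z c x"] p_scale[OF x, of c] x False by (simp add: c_def norm_divide)
    finally show ?thesis .
  qed
  have "f a = of_real (p a)"
  proof -
    have "inner (f a) 1 = p a" using f[OF a, of 1] u_a a by (simp add: scale_one)
    \<comment> \<open>real part \<open>p a\<close> and modulus at most \<open>p a\<close> leave only \<open>f a = p a\<close>\<close>
    then have "norm (f a - of_real (p a)) ^ 2 = norm (f a) ^ 2 - (p a) ^ 2"
      using inner_commute[of 1 "f a"] unfolding of_real_def
      by (simp only: power2_norm_eq_inner)
        (simp add: inner_diff_left inner_diff_right inner_one_one power2_eq_square)
    also have "\<dots> \<le> 0"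
      using f_norm[OF a] by (simp add: power_mono)
    finally show ?thesis by simp
  qed
  moreover have "f \<in> vcarrier (dual Z)"
  proof -
    have "f (x + y) = f x + f y" if "x \<in> vcarrier Z" "y \<in> vcarrier Z" for x y
      by (rule ext) (use that in \<open>simp add: f[symmetric] scale_right_distrib u_add
        distrib_left inner_add_left\<close>)
    moreover have "f (vscale Z d x) = d * f x" if "x \<in> vcarrier Z" for d x
      by (rule ext) (use that f[of x "_ * d"] in \<open>simp add: f[symmetric] scale_scale mult.assoc\<close>)
    moreover have "norm (f x) \<le> 1 * vnorm Z x" if "x \<in> vcarrier Z" for x
      using f_norm[OF that] p_le[OF that] by simp
    moreover have "f x = 0" if "x \<notin> vcarrier Z" for x
      using that by (simp add: f_def)
    ultimately show ?thesis unfolding dual_def by (auto intro!: exI[of _ 1])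
  qed
  ultimately show ?thesis using f_norm that by blast
qed

section \<open>Dual spaces\<close>

lemma dualI:
  assumes "\<And>x y. x \<in> vcarrier Z \<Longrightarrow> y \<in> vcarrier Z \<Longrightarrow> f (x + y) = f x + f y"
    and "\<And>c x. x \<in> vcarrier Z \<Longrightarrow> f (vscale Z c x) = c * f x"
    and "\<And>x. x \<in> vcarrier Z \<Longrightarrow> norm (f x) \<le> B * vnorm Z x"
    and "\<And>x. x \<notin> vcarrier Z \<Longrightarrow> f x = 0"
  shows "f \<in> vcarrier (dual Z)"
  using assms unfolding dual_def by (auto intro!: exI[of _ B])

lemma dualD:
  assumes "f \<in> vcarrier (dual Z)"
  shows dual_add: "x \<in> vcarrier Z \<Longrightarrow> y \<in> vcarrier Z \<Longrightarrow> f (x + y) = f x + f y"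
    and dual_scale: "x \<in> vcarrier Z \<Longrightarrow> f (vscale Z c x) = c * f x"
    and dual_off: "x \<notin> vcarrier Z \<Longrightarrow> f x = 0"
  using assms by (auto simp: dual_def)

lemma dual_zero: "f \<in> vcarrier (dual Z) \<Longrightarrow> f 0 = 0"
  using dual_add[of f 0 0] by simp

lemma dual_diff:
  assumes "f \<in> vcarrier (dual Z)" "x \<in> vcarrier Z" "y \<in> vcarrier Z"
  shows "f (x - y) = f x - f y"
  using dual_add[OF assms(1), of "x - y" y] assms(2,3) by simp

lemma dual_norm_eq: "vnorm (dual Z) f = (SUP x\<in>{x \<in> vcarrier Z. vnorm Z x \<le> 1}. norm (f x))"
  by (simp add: dual_def)

lemma dual_norm_le:
  assumes "0 \<le> B" and "\<And>x. x \<in> vcarrier Z \<Longrightarrow> norm (f x) \<le> B * vnorm Z x"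
  shows "vnorm (dual Z) f \<le> B"
proof -
  have "norm (f x) \<le> B" if "x \<in> vcarrier Z" "vnorm Z x \<le> 1" for x
    using assms(2)[OF that(1)] mult_left_mono[OF that(2) assms(1)] by simp
  moreover have "0 \<in> {x \<in> vcarrier Z. vnorm Z x \<le> 1}" by simp
  then have "{x \<in> vcarrier Z. vnorm Z x \<le> 1} \<noteq> {}" by blast
  ultimately show ?thesis
    unfolding dual_norm_eq by (intro cSUP_least) auto
qed

lemma dual_norm_bound:
  assumes f: "f \<in> vcarrier (dual Z)" and x: "x \<in> vcarrier Z"
  shows "norm (f x) \<le> vnorm (dual Z) f * vnorm Z x"
proof -
  obtain B where B: "\<And>x. x \<in> vcarrier Z \<Longrightarrow> norm (f x) \<le> B * vnorm Z x"
    using f unfolding dual_def by force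
  have "norm (f x) \<le> \<bar>B\<bar>" if "x \<in> vcarrier Z" "vnorm Z x \<le> 1" for x
  proof -
    have "norm (f x) \<le> \<bar>B\<bar> * vnorm Z x"
      using B[OF that(1)] mult_right_mono[OF abs_ge_self norm_nonneg[OF that(1)], of B] by simp
    also have "\<dots> \<le> \<bar>B\<bar>" using that by (simp add: mult_left_le)
    finally show ?thesis .
  qed
  then have bdd: "bdd_above ((\<lambda>x. norm (f x)) ` {x \<in> vcarrier Z. vnorm Z x \<le> 1})"
    by (intro bdd_aboveI2) auto
  show ?thesis
  proof (cases "vnorm Z x = 0")
    case True
    then show ?thesis using norm_eq_zero[OF x] dual_zero[OF f] by simp
  next
    case False
    then have pos: "0 < vnorm Z x" using norm_nonneg[OF x] by simp
    let ?y = "vscale Z (of_real (inverse (vnorm Z x))) x"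
    have "norm (f ?y) \<le> vnorm (dual Z) f"
      unfolding dual_norm_eq using pos x
      by (intro cSUP_upper[OF _ bdd]) (simp add: norm_scale norm_inverse)
    then show ?thesis
      using pos by (simp add: dual_scale[OF f x] norm_mult norm_divide field_simps)
  qed
qed


lemma dual_norm_nonneg: "f \<in> vcarrier (dual Z) \<Longrightarrow> 0 \<le> vnorm (dual Z) f"
proof -
  assume f: "f \<in> vcarrier (dual Z)"
  let ?S = "{x \<in> vcarrier Z. vnorm Z x \<le> 1}"
  have "norm (f x) \<le> \<bar>vnorm (dual Z) f\<bar>" if "x \<in> ?S" for x
    using dual_norm_bound[OF f, of x] that norm_nonneg[of x] 
    by (smt (verit) mem_Collect_eq mult_left_le mult_right_mono)
  then have "bdd_above ((\<lambda>x. norm (f x)) ` ?S)" by (intro bdd_aboveI2) auto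
  moreover have "0 \<in> ?S" by simp
  ultimately have "norm (f 0) \<le> vnorm (dual Z) f"
    unfolding dual_norm_eq by (intro cSUP_upper)
  then show ?thesis by (simp add: dual_zero[OF f])
qed

lemma normed_nspace_dual: "normed_nspace (dual Z)"
proof -
  have carrier: "vscale (dual Z) = (\<lambda>c f x. c * f x)" by (simp add: dual_def)
  have bound: "norm ((f + g) x) \<le> (vnorm (dual Z) f + vnorm (dual Z) g) * vnorm Z x"
    if "f \<in> vcarrier (dual Z)" "g \<in> vcarrier (dual Z)" "x \<in> vcarrier Z" for f g x
    using dual_norm_bound[OF that(1,3)] dual_norm_bound[OF that(2,3)] norm_triangle_ineq[of "f x" "g x"]
    by (simp add: distrib_right)
  have bound': "norm (c * f x) \<le> (norm c * vnorm (dual Z) f) * vnorm Z x"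
    if "f \<in> vcarrier (dual Z)" "x \<in> vcarrier Z" for f c x
    using mult_left_mono[OF dual_norm_bound[OF that], of "norm c"] by (simp add: norm_mult mult.assoc)
  have le: "vnorm (dual Z) (\<lambda>x. c * f x) \<le> norm c * vnorm (dual Z) f"
    if "f \<in> vcarrier (dual Z)" for f c
    using bound'[OF that] dual_norm_nonneg[OF that] by (intro dual_norm_le) auto
  have mem: "(\<lambda>x. c * f x) \<in> vcarrier (dual Z)" if "f \<in> vcarrier (dual Z)" for f c
    by (rule dualI[OF _ _ bound'[OF that]]) (auto simp: dualD[OF that] distrib_left)
  show ?thesis
  proof (unfold_locales, unfold carrier)
    show "0 \<in> vcarrier (dual Z)"
      by (rule dualI[where B = 0]) auto
    fix f assume f: "f \<in> vcarrier (dual Z)"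
    show "(\<lambda>x. 1 * f x) = f" by simp
    show "(\<lambda>x. c * f x) \<in> vcarrier (dual Z)" for c by (rule mem[OF f])
    show "(\<lambda>x. c * (d * f x)) = (\<lambda>x. c * d * f x)" for c d by (simp add: mult.assoc)
    show "(\<lambda>x. (c + d) * f x) = (\<lambda>x. c * f x) + (\<lambda>x. d * f x)" for c d
      by (simp add: fun_eq_iff distrib_right)
    show "f = 0" if "vnorm (dual Z) f = 0"
      using dual_norm_bound[OF f] dual_off[OF f] that by (fastforce simp: fun_eq_iff)
    show "vnorm (dual Z) (\<lambda>x. c * f x) = norm c * vnorm (dual Z) f" for c
    proof (cases "c = 0")
      case True
      then show ?thesis
        using le[OF f, of c] dual_norm_nonneg[OF mem[OF f, of c]] by simp
    next
      case False
      have "vnorm (dual Z) (\<lambda>x. inverse c * (c * f x)) \<le> norm (inverse c) * vnorm (dual Z) (\<lambda>x. c * f x)"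
        by (rule le[OF mem[OF f]])
      then have "vnorm (dual Z) f \<le> inverse (norm c) * vnorm (dual Z) (\<lambda>x. c * f x)"
        using False by (simp add: norm_inverse flip: mult.assoc)
      then show ?thesis
        using le[OF f, of c] False by (simp add: field_simps)
    qed
    fix g assume g: "g \<in> vcarrier (dual Z)"
    show "f + g \<in> vcarrier (dual Z)"
      by (rule dualI[OF _ _ bound[OF f g]]) (auto simp: dualD[OF f] dualD[OF g] distrib_left)
    show "vnorm (dual Z) (f + g) \<le> vnorm (dual Z) f + vnorm (dual Z) g"
      using bound[OF f g] dual_norm_nonneg[OF f] dual_norm_nonneg[OF g] by (intro dual_norm_le) auto
    show "(\<lambda>x. c * (f + g) x) = (\<lambda>x. c * f x) + (\<lambda>x. c * g x)" for c
      by (simp add: fun_eq_iff distrib_left)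
  qed
qed

lemma exists_norming_functional:
  assumes a: "a \<in> vcarrier Z"
  obtains f where "f \<in> vcarrier (dual Z)" "vnorm (dual Z) f \<le> 1" "f a = of_real (vnorm Z a)"
proof -
  obtain f where f: "f \<in> vcarrier (dual Z)" "\<And>x. x \<in> vcarrier Z \<Longrightarrow> norm (f x) \<le> vnorm Z x"
    "f a = of_real (vnorm Z a)"
    using hahn_banach[of "vnorm Z", OF norm_triangle eq_refl[OF norm_scale] order_refl a] by metis
  moreover have "vnorm (dual Z) f \<le> 1" using f(2) by (intro dual_norm_le) auto
  ultimately show ?thesis using that by blast
qed

lemma functionals_eq:
  assumes "f \<in> vcarrier (dual Z)" "g \<in> vcarrier (dual Z)" "\<And>x. x \<in> vcarrier Z \<Longrightarrow> f x = g x"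
  shows "f = g"
  using assms dual_off by (metis ext)

lemma functionals_separate:
  assumes "x \<in> vcarrier Z" "y \<in> vcarrier Z" "\<And>f. f \<in> vcarrier (dual Z) \<Longrightarrow> f x = f y"
  shows "x = y"
proof -
  obtain f where f: "f \<in> vcarrier (dual Z)" "f (x - y) = of_real (vnorm Z (x - y))"
    using exists_norming_functional[of "x - y"] assms(1,2) by auto
  have "of_real (vnorm Z (x - y)) = (0::'k)"
    using dual_diff[OF f(1) assms(1,2)] assms(3)[OF f(1)] f(2) by simp
  then show ?thesis using norm_eq_zero[of "x - y"] assms(1,2) by simp
qed

lemma dual_norm_eq_one:
  assumes "f \<in> vcarrier (dual Z)" "vnorm (dual Z) f \<le> 1" "x \<in> vcarrier Z" "vnorm Z x = 1" "f x = 1"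
  shows "vnorm (dual Z) f = 1"
  using dual_norm_bound[OF assms(1,3)] assms by simp

lemma canonical_embedding_apply:
  "f \<in> vcarrier (dual Z) \<Longrightarrow> canonical_embedding Z x f = f x"
  by (simp add: canonical_embedding_def)

lemma canonical_embedding_bound:
  assumes "x \<in> vcarrier Z" "f \<in> vcarrier (dual Z)"
  shows "norm (canonical_embedding Z x f) \<le> vnorm Z x * vnorm (dual Z) f"
  using dual_norm_bound[OF assms(2,1)] assms by (simp add: canonical_embedding_apply mult.commute)

lemma canonical_embedding_mem:
  assumes x: "x \<in> vcarrier Z"
  shows "canonical_embedding Z x \<in> vcarrier (dual (dual Z))"
proof -
  interpret D: normed_nspace "dual Z" by (rule normed_nspace_dual)
  have "vscale (dual Z) = (\<lambda>c f x. c * f x)" by (simp add: dual_def)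
  then show ?thesis
    by (intro D.dualI[OF _ _ canonical_embedding_bound[OF x]])
      (auto simp: canonical_embedding_def dest: D.add_mem D.scale_mem)
qed

lemma canonical_embedding_norm:
  assumes x: "x \<in> vcarrier Z"
  shows "vnorm (dual (dual Z)) (canonical_embedding Z x) = vnorm Z x"
proof (rule antisym)
  interpret D: normed_nspace "dual Z" by (rule normed_nspace_dual)
  show "vnorm (dual (dual Z)) (canonical_embedding Z x) \<le> vnorm Z x"
    by (intro D.dual_norm_le norm_nonneg canonical_embedding_bound x)
  obtain f where f: "f \<in> vcarrier (dual Z)" "vnorm (dual Z) f \<le> 1" "f x = of_real (vnorm Z x)"
    using exists_norming_functional[OF x] .
  have "vnorm Z x \<le> vnorm (dual (dual Z)) (canonical_embedding Z x) * vnorm (dual Z) f"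
    using D.dual_norm_bound[OF canonical_embedding_mem[OF x] f(1)] f norm_nonneg[OF x]
    by (simp add: canonical_embedding_apply)
  also have "\<dots> \<le> vnorm (dual (dual Z)) (canonical_embedding Z x)"
    using D.dual_norm_nonneg[OF canonical_embedding_mem[OF x]] f(2) by (simp add: mult_left_le)
  finally show "vnorm Z x \<le> vnorm (dual (dual Z)) (canonical_embedding Z x)" .
qed

lemma canonical_embedding_add:
  assumes "x \<in> vcarrier Z" "y \<in> vcarrier Z"
  shows "canonical_embedding Z (x + y) = canonical_embedding Z x + canonical_embedding Z y"
  using assms by (auto simp: canonical_embedding_def fun_eq_iff dual_add)

lemma canonical_embedding_diff:
  assumes "x \<in> vcarrier Z" "y \<in> vcarrier Z"
  shows "canonical_embedding Z (x - y) = canonical_embedding Z x - canonical_embedding Z y"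
  using assms by (auto simp: canonical_embedding_def fun_eq_iff dual_diff)

lemma canonical_embedding_scale:
  assumes "x \<in> vcarrier Z"
  shows "canonical_embedding Z (vscale Z c x) = vscale (dual (dual Z)) c (canonical_embedding Z x)"
  using assms by (auto simp: canonical_embedding_def fun_eq_iff dual_scale dual_def[of "dual Z"])

text \<open>
  Hahn--Banach separation of a point from a subspace: the distance to \<open>M\<close> is a seminorm below
  the norm, and a functional that it dominates vanishes on \<open>M\<close>.  In other words, the weak closure of a
  subspace is contained in its norm closure.
\<close>

lemma subspace_approximation:
  assumes M: "M \<subseteq> vcarrier Z" "0 \<in> M" "\<And>x y. x \<in> M \<Longrightarrow> y \<in> M \<Longrightarrow> x + y \<in> M"
      "\<And>c x. x \<in> M \<Longrightarrow> vscale Z c x \<in> M"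
    and a: "a \<in> vcarrier Z"
    and ann: "\<And>f. f \<in> vcarrier (dual Z) \<Longrightarrow> (\<And>x. x \<in> M \<Longrightarrow> f x = 0) \<Longrightarrow> f a = 0"
    and e: "0 < e"
  shows "\<exists>m\<in>M. vnorm Z (a - m) < e"
proof -
  define p where "p x = (INF m\<in>M. vnorm Z (x - m))" for x
  have MV: "\<And>m. m \<in> M \<Longrightarrow> m \<in> vcarrier Z" using M(1) by auto
  have bdd: "bdd_below ((\<lambda>m. vnorm Z (x - m)) ` M)" if "x \<in> vcarrier Z" for x
    using that MV by (intro bdd_belowI2[of _ 0] norm_nonneg diff_mem) auto
  have le: "p x \<le> vnorm Z (x - m)" if "x \<in> vcarrier Z" "m \<in> M" for x m
    unfolding p_def using bdd[OF that(1)] that(2) by (rule cINF_lower)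
  have ge: "b \<le> p x" if "\<And>m. m \<in> M \<Longrightarrow> b \<le> vnorm Z (x - m)" for b x
    unfolding p_def using M(2) that by (intro cINF_greatest) auto
  have p_add: "p (x + y) \<le> p x + p y" if xy: "x \<in> vcarrier Z" "y \<in> vcarrier Z" for x y
  proof -
    have *: "p (x + y) \<le> vnorm Z (x - m) + vnorm Z (y - m')" if "m \<in> M" "m' \<in> M" for m m'
    proof -
      have "p (x + y) \<le> vnorm Z (x + y - (m + m'))"
        using xy that M by (intro le) auto
      also have "x + y - (m + m') = (x - m) + (y - m')" by simp
      also have "vnorm Z \<dots> \<le> vnorm Z (x - m) + vnorm Z (y - m')"
        using xy that MV by (intro norm_triangle) auto
      finally show ?thesis .
    qed
    have "p (x + y) - vnorm Z (x - m) \<le> p y" if "m \<in> M" for m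
      by (rule ge) (use *[OF that] in \<open>simp add: algebra_simps\<close>)
    then have "p (x + y) - p y \<le> p x" by (intro ge) (simp add: algebra_simps)
    then show ?thesis by simp
  qed
  have p_le: "p x \<le> vnorm Z x" if "x \<in> vcarrier Z" for x
    using le[OF that M(2)] by simp
  have p_scale: "p (vscale Z c x) \<le> norm c * p x" if x: "x \<in> vcarrier Z" for c x
  proof (cases "c = 0")
    case True
    then show ?thesis using le[OF zero_mem M(2)] x by (simp add: scale_zero_left)
  next
    case False
    have "p (vscale Z c x) / norm c \<le> p x"
    proof (rule ge)
      fix m assume m: "m \<in> M"
      have "p (vscale Z c x) \<le> vnorm Z (vscale Z c x - vscale Z c m)"
        using x m M by (intro le) auto
      also have "vscale Z c x - vscale Z c m = vscale Z c (x - m)"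
        using scale_right_distrib[of "x - m" m c] x m MV by simp
      also have "vnorm Z \<dots> = norm c * vnorm Z (x - m)"
        using x m MV by (intro norm_scale) auto
      finally show "p (vscale Z c x) / norm c \<le> vnorm Z (x - m)"
        using False by (simp add: field_simps)
    qed
    then show ?thesis using False by (simp add: field_simps)
  qed
  obtain f where f: "f \<in> vcarrier (dual Z)" "\<And>x. x \<in> vcarrier Z \<Longrightarrow> norm (f x) \<le> p x"
    "f a = of_real (p a)"
    using hahn_banach[of p, OF p_add p_scale p_le a] by metis
  have "f x = 0" if "x \<in> M" for x
  proof -
    have "norm (f x) \<le> 0" using f(2)[OF MV[OF that]] le[OF MV[OF that] that] by (simp del: norm_le_zero_iff)
    then show ?thesis by simp
  qed
  then have "p a = 0" using ann[OF f(1)] f(3) by simp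
  then show ?thesis
    using e ge[of e a] by force
qed

end

section \<open>Bounded maps and their adjoints\<close>

definition bounded_map ::
  "('k::real_or_complex, 'v::ab_group_add) nspace \<Rightarrow> ('k, 'w::ab_group_add) nspace \<Rightarrow> real \<Rightarrow> ('v \<Rightarrow> 'w) \<Rightarrow> bool"
  where
  "bounded_map Z W C A \<longleftrightarrow> 0 \<le> C \<and>
     (\<forall>x\<in>vcarrier Z. A x \<in> vcarrier W \<and> vnorm W (A x) \<le> C * vnorm Z x) \<and>
     (\<forall>x\<in>vcarrier Z. \<forall>y\<in>vcarrier Z. A (x + y) = A x + A y) \<and>
     (\<forall>c. \<forall>x\<in>vcarrier Z. A (vscale Z c x) = vscale W c (A x))"

text \<open>
  The Banach space adjoint \<open>A\<^sup>*\<close>.  It is cut off outside the carrier because the elements of \<open>dual Z\<close>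
  vanish there.
\<close>

definition dual_map ::
  "('k::real_or_complex, 'v::ab_group_add) nspace \<Rightarrow> ('v \<Rightarrow> 'w) \<Rightarrow> ('w \<Rightarrow> 'k) \<Rightarrow> 'v \<Rightarrow> 'k" where
  "dual_map Z A g = (\<lambda>x. if x \<in> vcarrier Z then g (A x) else 0)"

lemma bounded_mapD:
  assumes "bounded_map Z W C A"
  shows "0 \<le> C" "x \<in> vcarrier Z \<Longrightarrow> A x \<in> vcarrier W"
    "x \<in> vcarrier Z \<Longrightarrow> vnorm W (A x) \<le> C * vnorm Z x"
    "x \<in> vcarrier Z \<Longrightarrow> y \<in> vcarrier Z \<Longrightarrow> A (x + y) = A x + A y"
    "x \<in> vcarrier Z \<Longrightarrow> A (vscale Z c x) = vscale W c (A x)"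
  using assms by (auto simp: bounded_map_def)

lemma vscale_dual [simp]: "vscale (dual Z) c f = (\<lambda>x. c * f x)"
  by (simp add: dual_def)

lemma bounded_map_dual_map:
  assumes Z: "normed_nspace Z" and W: "normed_nspace W" and A: "bounded_map Z W C A"
  shows "bounded_map (dual W) (dual Z) C (dual_map Z A)"
proof -
  interpret Z: normed_nspace Z by fact
  interpret W: normed_nspace W by fact
  note A = bounded_mapD[OF A]
  have bound: "norm (dual_map Z A g x) \<le> (C * vnorm (dual W) g) * vnorm Z x"
    if g: "g \<in> vcarrier (dual W)" and x: "x \<in> vcarrier Z" for g x
  proof -
    have "norm (dual_map Z A g x) \<le> vnorm (dual W) g * vnorm W (A x)"
      using W.dual_norm_bound[OF g A(2)[OF x]] x by (simp add: dual_map_def)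
    also have "\<dots> \<le> vnorm (dual W) g * (C * vnorm Z x)"
      using A(3)[OF x] W.dual_norm_nonneg[OF g] by (rule mult_left_mono)
    finally show ?thesis by (simp add: mult_ac)
  qed
  have mem: "dual_map Z A g \<in> vcarrier (dual Z)" if g: "g \<in> vcarrier (dual W)" for g
    by (rule Z.dualI[OF _ _ bound[OF g]])
      (auto simp: dual_map_def A W.dual_add[OF g] W.dual_scale[OF g])
  have le: "vnorm (dual Z) (dual_map Z A g) \<le> C * vnorm (dual W) g" if g: "g \<in> vcarrier (dual W)" for g
    using bound[OF g] W.dual_norm_nonneg[OF g] A(1) by (intro Z.dual_norm_le) auto
  show ?thesis
    using mem le A(1) by (auto simp: bounded_map_def) (auto simp: dual_map_def fun_eq_iff)
qed

lemma dual_map_canonical_embedding: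
  assumes Z: "normed_nspace Z" and W: "normed_nspace W" and A: "bounded_map Z W C A"
    and x: "x \<in> vcarrier Z"
  shows "dual_map (dual W) (dual_map Z A) (canonical_embedding Z x) = canonical_embedding W (A x)"
  using bounded_mapD(2)[OF bounded_map_dual_map[OF Z W A]] x
  by (auto simp: dual_map_def canonical_embedding_def fun_eq_iff)

lemma dual_map_right_inverse:
  assumes W: "normed_nspace W" and r: "bounded_map W Z C r"
    and er: "\<And>w. w \<in> vcarrier W \<Longrightarrow> e (r w) = w" and g: "g \<in> vcarrier (dual W)"
  shows "dual_map W r (dual_map Z e g) = g"
  using bounded_mapD(2)[OF r] er normed_nspace.dual_off[OF W g]
  by (auto simp: dual_map_def fun_eq_iff)

section \<open>Smooth and very smooth points\<close>

context normed_nspace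
begin

text \<open>
  A norming functional exists by Hahn--Banach, so smoothness is uniqueness alone; moreover it
  suffices to compare functionals of norm at most one, as the value at \<open>x\<close> makes the norm one.
\<close>

lemma smooth_point_iff:
  "smooth_point Z x \<longleftrightarrow> x \<in> vcarrier Z \<and> vnorm Z x = 1 \<and>
    (\<forall>f g. f \<in> vcarrier (dual Z) \<and> vnorm (dual Z) f \<le> 1 \<and> f x = 1 \<and>
      g \<in> vcarrier (dual Z) \<and> vnorm (dual Z) g \<le> 1 \<and> g x = 1 \<longrightarrow> f = g)" (is "?L \<longleftrightarrow> ?R")
proof
  assume ?L
  then have x: "x \<in> vcarrier Z" "vnorm Z x = 1" by (auto simp: smooth_point_def)
  moreover have "f = g" if "f \<in> vcarrier (dual Z) \<and> vnorm (dual Z) f \<le> 1 \<and> f x = 1 \<and>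
      g \<in> vcarrier (dual Z) \<and> vnorm (dual Z) g \<le> 1 \<and> g x = 1" for f g
    using \<open>?L\<close> that dual_norm_eq_one[of f x] dual_norm_eq_one[of g x] x
    unfolding smooth_point_def by blast
  ultimately show ?R by blast
next
  assume R: ?R
  then obtain f where f: "f \<in> vcarrier (dual Z)" "vnorm (dual Z) f \<le> 1" "f x = 1"
    using exists_norming_functional[of x] by auto
  then have "vnorm (dual Z) f = 1" using R dual_norm_eq_one by blast
  then show ?L
    unfolding smooth_point_def using R f by (auto intro!: ex1I[of _ f])
qed

lemma very_smooth_point_iff:
  "very_smooth_point Z x \<longleftrightarrow> x \<in> vcarrier Z \<and> vnorm Z x = 1 \<and>
    (\<forall>F G. F \<in> vcarrier (dual (dual (dual Z))) \<and> vnorm (dual (dual (dual Z))) F \<le> 1 \<and>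
        F (canonical_embedding Z x) = 1 \<and>
        G \<in> vcarrier (dual (dual (dual Z))) \<and> vnorm (dual (dual (dual Z))) G \<le> 1 \<and>
        G (canonical_embedding Z x) = 1 \<longrightarrow> F = G)"
proof -
  interpret DD: normed_nspace "dual (dual Z)"
    by (intro normed_nspace.normed_nspace_dual normed_nspace_axioms)
  show ?thesis
    unfolding very_smooth_point_def DD.smooth_point_iff
    using canonical_embedding_mem canonical_embedding_norm by auto
qed

text \<open>
  Very smooth points are smooth, as \<open>Z\<^sup>*\<close> embeds isometrically into \<open>Z\<^sup>*\<^sup>*\<^sup>*\<close>.
\<close>

lemma very_smooth_point_unique:
  assumes vs: "very_smooth_point Z x"
    and f: "f \<in> vcarrier (dual Z)" "vnorm (dual Z) f \<le> 1" "f x = 1"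
    and g: "g \<in> vcarrier (dual Z)" "vnorm (dual Z) g \<le> 1" "g x = 1"
  shows "f = g"
proof (rule functionals_eq[OF f(1) g(1)])
  interpret D: normed_nspace "dual Z" by (rule normed_nspace_dual)
  fix z assume z: "z \<in> vcarrier Z"
  have x: "x \<in> vcarrier Z" using vs by (simp add: very_smooth_point_def)
  have "canonical_embedding (dual Z) f = canonical_embedding (dual Z) g"
    using vs D.canonical_embedding_mem[OF f(1)] D.canonical_embedding_mem[OF g(1)]
      D.canonical_embedding_norm[OF f(1)] D.canonical_embedding_norm[OF g(1)] f g
      canonical_embedding_mem[OF x]
    by (auto simp: very_smooth_point_iff canonical_embedding_apply D.canonical_embedding_apply)
  from fun_cong[OF this, of "canonical_embedding Z z"] show "f z = g z"
    using f g canonical_embedding_mem[OF z]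
    by (simp add: canonical_embedding_apply D.canonical_embedding_apply)
qed

text \<open>
  The Banach--Alaoglu theorem for limits along an ultrafilter.
\<close>

lemma alaoglu_ultrafilter:
  assumes G: "ultrafilter G" and \<phi>: "\<And>i. \<phi> i \<in> vcarrier (dual Z)" "\<And>i. vnorm (dual Z) (\<phi> i) \<le> 1"
  obtains f where "f \<in> vcarrier (dual Z)" "vnorm (dual Z) f \<le> 1"
    "\<And>x. x \<in> vcarrier Z \<Longrightarrow> ((\<lambda>i. \<phi> i x) \<longlongrightarrow> f x) G"
proof -
  have nb: "G \<noteq> bot" using G by (simp add: ultrafilter_def)
  have le: "norm (\<phi> i x) \<le> 1 * vnorm Z x" if "x \<in> vcarrier Z" for i x
    using dual_norm_bound[OF \<phi>(1) that, of i] mult_right_mono[OF \<phi>(2)[of i] norm_nonneg[OF that]]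
    by simp
  have "\<exists>l. ((\<lambda>i. \<phi> i x) \<longlongrightarrow> l) G" if "x \<in> vcarrier Z" for x
    using ultrafilter_tendsto_compact[OF G compact_cball[of 0 "vnorm Z x"], of "\<lambda>i. \<phi> i x"] le[OF that]
    by auto
  then obtain g where g: "\<And>x. x \<in> vcarrier Z \<Longrightarrow> ((\<lambda>i. \<phi> i x) \<longlongrightarrow> g x) G" by metis
  define f where "f x = (if x \<in> vcarrier Z then g x else 0)" for x
  have f: "((\<lambda>i. \<phi> i x) \<longlongrightarrow> f x) G" if "x \<in> vcarrier Z" for x
    using g that by (simp add: f_def)
  have f_le: "norm (f x) \<le> 1 * vnorm Z x" if "x \<in> vcarrier Z" for x
    by (rule tendsto_upperbound[OF tendsto_norm[OF f[OF that]] _ nb]) (use le[OF that] in simp)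
  have "f \<in> vcarrier (dual Z)"
  proof (rule dualI[OF _ _ f_le])
    show "f (x + y) = f x + f y" if xy: "x \<in> vcarrier Z" "y \<in> vcarrier Z" for x y
      using tendsto_unique[OF nb f[of "x + y"] tendsto_add[OF f[OF xy(1)] f[OF xy(2)],
            folded dual_add[OF \<phi>(1) xy]]] xy by simp
    show "f (vscale Z c x) = c * f x" if x: "x \<in> vcarrier Z" for c x
      using tendsto_unique[OF nb f[of "vscale Z c x"] tendsto_mult_left[OF f[OF x],
            folded dual_scale[OF \<phi>(1) x]]] x by simp
  qed (auto simp: f_def)
  moreover have "vnorm (dual Z) f \<le> 1"
    using f_le by (intro dual_norm_le) auto
  ultimately show ?thesis using f that by blast
qed

text \<open>
  At a very smooth point, norming sequences converge weakly: the limits of \<open>\<Psi> (\<phi> i)\<close> define an element of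
  the unit ball of \<open>Z\<^sup>*\<^sup>*\<^sup>*\<close> that is norming at \<open>x\<close>, and evaluation at \<open>f\<close> is another one.
\<close>

lemma very_smooth_weak_convergence:
  assumes vs: "very_smooth_point Z x" and G: "ultrafilter G"
    and \<phi>: "\<And>i. \<phi> i \<in> vcarrier (dual Z)" "\<And>i. vnorm (dual Z) (\<phi> i) \<le> 1"
      "((\<lambda>i. \<phi> i x) \<longlongrightarrow> 1) G"
    and f: "f \<in> vcarrier (dual Z)" "vnorm (dual Z) f \<le> 1" "f x = 1"
    and \<Psi>: "\<Psi> \<in> vcarrier (dual (dual Z))"
  shows "((\<lambda>i. \<Psi> (\<phi> i)) \<longlongrightarrow> \<Psi> f) G"
proof -
  interpret D: normed_nspace "dual Z" by (rule normed_nspace_dual)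
  interpret DD: normed_nspace "dual (dual Z)" by (rule D.normed_nspace_dual)
  have x: "x \<in> vcarrier Z" using vs by (simp add: very_smooth_point_def)
  obtain F where F: "F \<in> vcarrier (dual (dual (dual Z)))" "vnorm (dual (dual (dual Z))) F \<le> 1"
    "\<And>\<Psi>. \<Psi> \<in> vcarrier (dual (dual Z)) \<Longrightarrow>
      ((\<lambda>i. canonical_embedding (dual Z) (\<phi> i) \<Psi>) \<longlongrightarrow> F \<Psi>) G"
    using DD.alaoglu_ultrafilter[OF G, of "\<lambda>i. canonical_embedding (dual Z) (\<phi> i)"]
      D.canonical_embedding_mem[OF \<phi>(1)] D.canonical_embedding_norm[OF \<phi>(1)] \<phi>(2) by metis
  have lim: "((\<lambda>i. \<Psi> (\<phi> i)) \<longlongrightarrow> F \<Psi>) G" if "\<Psi> \<in> vcarrier (dual (dual Z))" for \<Psi>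
    using F(3)[OF that] that by (simp add: D.canonical_embedding_apply)
  let ?x = "canonical_embedding Z x"
  have "((\<lambda>i. \<phi> i x) \<longlongrightarrow> F ?x) G"
    using lim[OF canonical_embedding_mem[OF x]] by (simp add: canonical_embedding_apply \<phi>(1))
  then have "F ?x = 1"
    using \<phi>(3) G tendsto_unique unfolding ultrafilter_def by blast
  moreover have "canonical_embedding (dual Z) f ?x = 1"
    using f canonical_embedding_mem[OF x] by (simp add: canonical_embedding_apply D.canonical_embedding_apply)
  ultimately have "F = canonical_embedding (dual Z) f"
    using vs F(1,2) f D.canonical_embedding_mem[OF f(1)] D.canonical_embedding_norm[OF f(1)]
    unfolding very_smooth_point_iff by metis
  then show ?thesis
    using lim[OF \<Psi>] \<Psi> by (simp add: D.canonical_embedding_apply)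
qed

end

text \<open>
  The third adjoint of \<open>e\<close> carries functionals norming at \<open>e z\<close> to functionals norming at \<open>z\<close>, of which
  there is only one.  It is injective, because \<open>e\<^sup>*\<^sup>* \<circ> r\<^sup>*\<^sup>*\<close> is the identity.
\<close>

lemma very_smooth_point_retract:
  assumes Z: "normed_nspace Z" and W: "normed_nspace W"
    and e: "bounded_map Z W 1 e" and r: "bounded_map W Z C r"
    and er: "\<And>w. w \<in> vcarrier W \<Longrightarrow> e (r w) = w"
    and vs: "very_smooth_point Z z" and norm: "vnorm W (e z) = 1"
  shows "very_smooth_point W (e z)"
proof -
  interpret Z: normed_nspace Z by fact
  interpret W: normed_nspace W by fact
  interpret DZ: normed_nspace "dual Z" by (rule Z.normed_nspace_dual)
  interpret DW: normed_nspace "dual W" by (rule W.normed_nspace_dual)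
  interpret DDZ: normed_nspace "dual (dual Z)" by (rule DZ.normed_nspace_dual)
  interpret DDW: normed_nspace "dual (dual W)" by (rule DW.normed_nspace_dual)
  interpret DDDW: normed_nspace "dual (dual (dual W))" by (rule DDW.normed_nspace_dual)
  note e' = bounded_map_dual_map[OF Z W e] and r' = bounded_map_dual_map[OF W Z r]
  note e'' = bounded_map_dual_map[OF DW.normed_nspace_axioms DZ.normed_nspace_axioms e']
    and r'' = bounded_map_dual_map[OF DZ.normed_nspace_axioms DW.normed_nspace_axioms r']
  let ?e = "dual_map (dual W) (dual_map Z e)" and ?r = "dual_map (dual Z) (dual_map W r)"
  let ?t = "dual_map (dual (dual Z)) ?e"
  note t = bounded_map_dual_map[OF DDZ.normed_nspace_axioms DDW.normed_nspace_axioms e'']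
  have z: "z \<in> vcarrier Z" using vs by (simp add: very_smooth_point_def)
  have retr: "?e (?r \<Psi>) = \<Psi>" if "\<Psi> \<in> vcarrier (dual (dual W))" for \<Psi>
    using dual_map_right_inverse[OF DW.normed_nspace_axioms e', of "dual_map W r" \<Psi>]
      dual_map_right_inverse[OF W r er] that by blast
  have t1: "?t F \<in> vcarrier (dual (dual (dual Z))) \<and> vnorm (dual (dual (dual Z))) (?t F) \<le> 1 \<and>
      ?t F (canonical_embedding Z z) = 1"
    if F: "F \<in> vcarrier (dual (dual (dual W)))" "vnorm (dual (dual (dual W))) F \<le> 1"
      "F (canonical_embedding W (e z)) = 1" for F
  proof -
    have "?t F (canonical_embedding Z z) = F (?e (canonical_embedding Z z))"
      using Z.canonical_embedding_mem[OF z] by (simp add: dual_map_def[of "dual (dual Z)"])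
    then show ?thesis
      using bounded_mapD(2,3)[OF t F(1)] F dual_map_canonical_embedding[OF Z W e z] by simp
  qed
  have t_inj: "F = F'" if F: "F \<in> vcarrier (dual (dual (dual W)))" "F' \<in> vcarrier (dual (dual (dual W)))"
    and eq: "?t F = ?t F'" for F F'
  proof
    fix \<Psi>
    show "F \<Psi> = F' \<Psi>"
    proof (cases "\<Psi> \<in> vcarrier (dual (dual W))")
      case True
      have "F \<Psi> = ?t F (?r \<Psi>)" if "F \<in> vcarrier (dual (dual (dual W)))" for F
        using retr[OF True] bounded_mapD(2)[OF r'' True] by (simp add: dual_map_def[of "dual (dual Z)"])
      then show ?thesis using F eq by metis
    next
      case False
      then show ?thesis using F DDW.dual_off by metis
    qed
  qed
  show ?thesis
    unfolding W.very_smooth_point_iff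
  proof (intro conjI allI impI)
    show "e z \<in> vcarrier W" using bounded_mapD(2)[OF e z] .
    show "vnorm W (e z) = 1" by fact
    fix F F'
    assume h: "F \<in> vcarrier (dual (dual (dual W))) \<and> vnorm (dual (dual (dual W))) F \<le> 1 \<and>
      F (canonical_embedding W (e z)) = 1 \<and>
      F' \<in> vcarrier (dual (dual (dual W))) \<and> vnorm (dual (dual (dual W))) F' \<le> 1 \<and>
      F' (canonical_embedding W (e z)) = 1"
    then have "?t F = ?t F'"
      using t1[of F] t1[of F'] vs unfolding Z.very_smooth_point_iff by blast
    then show "F = F'" using h t_inj by blast
  qed
qed

section \<open>Banach spaces inside their biduals\<close>

lemma normed_nspace_space_of:
  assumes "banach_space_over s"
  shows "normed_nspace (space_of s)"
proof -
  interpret banach_space_over s by fact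
  show ?thesis
    by unfold_locales
      (auto simp: space_of_def norm_scale norm_triangle_ineq scale_left_distrib scale_right_distrib)
qed

lemma space_of_simps [simp]:
  "vcarrier (space_of s) = UNIV" "vnorm (space_of s) = norm" "vscale (space_of s) = s"
  by (simp_all add: space_of_def)

text \<open>
  The canonical embedding is isometric, so its range is complete and thus closed.
\<close>

lemma (in banach_space_over) canonical_range_closed:
  assumes \<xi>: "\<xi> \<in> vcarrier (dual (dual (space_of scale)))"
    and approx: "\<And>e. 0 < e \<Longrightarrow>
      \<exists>x. vnorm (dual (dual (space_of scale))) (\<xi> - canonical_embedding (space_of scale) x) < e"
  obtains x where "\<xi> = canonical_embedding (space_of scale) x"
proof -
  let ?X = "space_of scale" and ?j = "canonical_embedding (space_of scale)"
  interpret N: normed_nspace ?X by (rule normed_nspace_space_of) unfold_locales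
  interpret D: normed_nspace "dual ?X" by (rule N.normed_nspace_dual)
  interpret DD: normed_nspace "dual (dual ?X)" by (rule D.normed_nspace_dual)
  have j: "?j x \<in> vcarrier (dual (dual ?X))" for x by (rule N.canonical_embedding_mem) simp
  obtain u where u: "\<And>n. vnorm (dual (dual ?X)) (\<xi> - ?j (u n)) < inverse (real (Suc n))"
    using approx[of "inverse (real (Suc _))"] by (metis inverse_positive_iff_positive of_nat_0_less_iff zero_less_Suc)
  have tri: "norm (x - y) \<le> vnorm (dual (dual ?X)) (\<xi> - ?j x) + vnorm (dual (dual ?X)) (\<xi> - ?j y)"
    for x y
  proof -
    have "norm (x - y) = vnorm (dual (dual ?X)) (?j x - ?j y)"
      using N.canonical_embedding_norm[of "x - y"] N.canonical_embedding_diff[of x y] by simp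
    also have "?j x - ?j y = - (\<xi> - ?j x) + (\<xi> - ?j y)" by simp
    also have "vnorm (dual (dual ?X)) \<dots>
        \<le> vnorm (dual (dual ?X)) (- (\<xi> - ?j x)) + vnorm (dual (dual ?X)) (\<xi> - ?j y)"
      using j \<xi> by (intro DD.norm_triangle DD.minus_mem DD.diff_mem)
    also have "vnorm (dual (dual ?X)) (- (\<xi> - ?j x)) = vnorm (dual (dual ?X)) (\<xi> - ?j x)"
      using j \<xi> by (intro DD.norm_minus DD.diff_mem)
    finally show ?thesis .
  qed
  have "Cauchy u"
  proof (rule metric_CauchyI)
    fix e :: real assume "0 < e"
    then obtain N where N: "inverse (real (Suc N)) < e / 2"
      using reals_Archimedean[of "e / 2"] by auto
    have "dist (u m) (u n) < e" if "N \<le> m" "N \<le> n" for m n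
    proof -
      have "inverse (real (Suc m)) \<le> inverse (real (Suc N))" "inverse (real (Suc n)) \<le> inverse (real (Suc N))"
        using that by (auto intro!: le_imp_inverse_le)
      then show ?thesis
        using tri[of "u m" "u n"] u[of m] u[of n] N unfolding dist_norm by linarith
    qed
    then show "\<exists>M. \<forall>m\<ge>M. \<forall>n\<ge>M. dist (u m) (u n) < e" by blast
  qed
  then obtain x where x: "u \<longlonglongrightarrow> x" by (auto simp: Cauchy_convergent_iff convergent_def)
  have "vnorm (dual (dual ?X)) (\<xi> - ?j x) \<le> inverse (real (Suc n)) + norm (u n - x)" for n
  proof -
    have "\<xi> - ?j x = (\<xi> - ?j (u n)) + ?j (u n - x)"
      using N.canonical_embedding_diff[of "u n" x] by simp
    then have "vnorm (dual (dual ?X)) (\<xi> - ?j x)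
        \<le> vnorm (dual (dual ?X)) (\<xi> - ?j (u n)) + vnorm (dual (dual ?X)) (?j (u n - x))"
      using DD.norm_triangle[OF DD.diff_mem[OF \<xi> j[of "u n"]] j[of "u n - x"]] by (simp only:)
    also have "vnorm (dual (dual ?X)) (?j (u n - x)) = norm (u n - x)"
      using N.canonical_embedding_norm[of "u n - x"] by simp
    finally show ?thesis using u[of n] by linarith
  qed
  moreover have "(\<lambda>n. inverse (real (Suc n)) + norm (u n - x)) \<longlonglongrightarrow> 0 + 0"
    using x by (intro tendsto_add LIMSEQ_inverse_real_of_nat tendsto_norm_zero) (simp add: LIM_zero_iff)
  ultimately have "vnorm (dual (dual ?X)) (\<xi> - ?j x) \<le> 0"
    by (intro LIMSEQ_le_const[of _ 0]) auto
  then have "\<xi> - ?j x = 0"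
    using D.dual_norm_nonneg[of "\<xi> - ?j x"] DD.norm_eq_zero[of "\<xi> - ?j x"] DD.diff_mem[OF \<xi> j] by simp
  then show ?thesis using that[of x] by simp
qed

section \<open>Spaces of operators\<close>

locale operator_space =
  X: banach_space_over sX + Y: banach_space_over sY
  for sX :: "'k::real_or_complex \<Rightarrow> 'a::banach \<Rightarrow> 'a" and sY :: "'k \<Rightarrow> 'b::banach \<Rightarrow> 'b"
begin

sublocale NX: normed_nspace "space_of sX"
  by (rule normed_nspace_space_of) unfold_locales
sublocale NY: normed_nspace "space_of sY"
  by (rule normed_nspace_space_of) unfold_locales

abbreviation "L \<equiv> bounded_ops sX sY"

lemma L_simps [simp]: "vnorm L = onorm" "vscale L c S = (\<lambda>x. sY c (S x))"
  by (simp_all add: bounded_ops_def)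

lemma bounded_opsI:
  assumes "\<And>x y. S (x + y) = S x + S y" "\<And>c x. S (sX c x) = sY c (S x)"
    "\<And>x. norm (S x) \<le> B * norm x"
  shows "S \<in> vcarrier L"
proof -
  have "Vector_Spaces.linear sX sY S"
    using assms(1,2) by unfold_locales auto
  moreover have "bounded_linear S"
    using assms(1,3) assms(2)[of "of_real _"]
    by (intro bounded_linear_intro[where K = B]) (auto simp: X.scale_of_real Y.scale_of_real mult.commute)
  ultimately show ?thesis by (simp add: bounded_ops_def)
qed

lemma bounded_opsD:
  assumes "S \<in> vcarrier L"
  shows L_add: "S (x + y) = S x + S y" and L_scale: "S (sX c x) = sY c (S x)"
    and L_bounded: "bounded_linear S" and L_bound: "norm (S x) \<le> onorm S * norm x"
proof -
  interpret S: Vector_Spaces.linear sX sY S using assms by (simp add: bounded_ops_def)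
  show "S (x + y) = S x + S y" "S (sX c x) = sY c (S x)" by (rule S.add S.scale)+
  show "bounded_linear S" using assms by (simp add: bounded_ops_def)
  then show "norm (S x) \<le> onorm S * norm x" by (rule onorm)
qed

sublocale NL: normed_nspace L
proof -
  have scale_bound: "norm (sY c (S x)) \<le> (norm c * onorm S) * norm x" if "S \<in> vcarrier L" for c S x
    using mult_left_mono[OF L_bound[OF that], of "norm c"] by (simp add: Y.norm_scale mult.assoc)
  have mem: "(\<lambda>x. sY c (S x)) \<in> vcarrier L" if "S \<in> vcarrier L" for c S
    by (rule bounded_opsI[OF _ _ scale_bound[OF that]])
      (auto simp: bounded_opsD[OF that] Y.scale_right_distrib mult.commute)
  have pos: "0 \<le> onorm S" if "S \<in> vcarrier L" for S
    using L_bounded[OF that] by (rule onorm_pos_le)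
  have le: "onorm (\<lambda>x. sY c (S x)) \<le> norm c * onorm S" if "S \<in> vcarrier L" for c S
    using scale_bound[OF that] pos[OF that] by (intro onorm_bound) auto
  show "normed_nspace L"
  proof (unfold_locales, unfold L_simps)
    show "0 \<in> vcarrier L" by (rule bounded_opsI[where B = 0]) auto
    fix S assume S: "S \<in> vcarrier L"
    show "(\<lambda>x. sY 1 (S x)) = S" by simp
    show "(\<lambda>x. sY c (S x)) \<in> vcarrier L" for c by (rule mem[OF S])
    show "(\<lambda>x. sY c (sY d (S x))) = (\<lambda>x. sY (c * d) (S x))" for c d by simp
    show "(\<lambda>x. sY (c + d) (S x)) = (\<lambda>x. sY c (S x)) + (\<lambda>x. sY d (S x))" for c d
      by (simp add: fun_eq_iff Y.scale_left_distrib)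
    show "S = 0" if "onorm S = 0"
      using onorm_eq_0[OF L_bounded[OF S]] that by (simp add: fun_eq_iff)
    show "onorm (\<lambda>x. sY c (S x)) = norm c * onorm S" for c
    proof (cases "c = 0")
      case True
      then show ?thesis by (simp add: onorm_zero)
    next
      case False
      have "onorm (\<lambda>x. sY (inverse c) (sY c (S x))) \<le> norm (inverse c) * onorm (\<lambda>x. sY c (S x))"
        by (rule le[OF mem[OF S]])
      then have "onorm S \<le> inverse (norm c) * onorm (\<lambda>x. sY c (S x))"
        using False by (simp add: norm_inverse)
      then show ?thesis using le[OF S, of c] False by (simp add: field_simps)
    qed
    fix S' assume S': "S' \<in> vcarrier L"
    show "S + S' \<in> vcarrier L"
      by (rule bounded_opsI[where B = "onorm S + onorm S'"])
        (use norm_triangle_le[OF add_mono[OF L_bound[OF S] L_bound[OF S']]] in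
          \<open>auto simp: bounded_opsD[OF S] bounded_opsD[OF S'] Y.scale_right_distrib distrib_right\<close>)
    show "onorm (S + S') \<le> onorm S + onorm S'"
      using onorm_triangle[OF L_bounded[OF S] L_bounded[OF S']] by (simp add: plus_fun_def)
    show "(\<lambda>x. sY c ((S + S') x)) = (\<lambda>x. sY c (S x)) + (\<lambda>x. sY c (S' x))" for c
      by (simp add: fun_eq_iff Y.scale_right_distrib)
  qed
qed

definition rank_one :: "('a \<Rightarrow> 'k) \<Rightarrow> 'b \<Rightarrow> 'a \<Rightarrow> 'b" where
  "rank_one f y = (\<lambda>v. sY (f v) y)"

lemma rank_one_bound:
  assumes "f \<in> vcarrier (dual (space_of sX))"
  shows "norm (rank_one f y v) \<le> (vnorm (dual (space_of sX)) f * norm y) * norm v"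
  using mult_right_mono[OF NX.dual_norm_bound[OF assms, of v], of "norm y"]
  by (simp add: rank_one_def Y.norm_scale mult_ac)

lemma rank_one_mem:
  assumes "f \<in> vcarrier (dual (space_of sX))"
  shows "rank_one f y \<in> vcarrier L"
  by (rule bounded_opsI[OF _ _ rank_one_bound[OF assms]])
    (use NX.dual_add[OF assms] NX.dual_scale[OF assms] in
      \<open>simp_all add: rank_one_def Y.scale_left_distrib\<close>)

lemma onorm_rank_one_le:
  assumes "f \<in> vcarrier (dual (space_of sX))"
  shows "onorm (rank_one f y) \<le> vnorm (dual (space_of sX)) f * norm y"
  using rank_one_bound[OF assms] NX.dual_norm_nonneg[OF assms] by (intro onorm_bound) auto

lemma bounded_map_rank_one_left:
  "bounded_map (dual (space_of sX)) L (norm y) (\<lambda>f. rank_one f y)"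
  unfolding bounded_map_def using rank_one_mem onorm_rank_one_le
  by (auto simp: rank_one_def fun_eq_iff Y.scale_left_distrib mult.commute)

lemma bounded_map_rank_one_right:
  assumes "f \<in> vcarrier (dual (space_of sX))"
  shows "bounded_map (space_of sY) L (vnorm (dual (space_of sX)) f) (rank_one f)"
  unfolding bounded_map_def
  using rank_one_mem[OF assms] onorm_rank_one_le[OF assms] NX.dual_norm_nonneg[OF assms]
  by (auto simp: rank_one_def fun_eq_iff Y.scale_right_distrib mult.commute)

lemma rank_one_compact:
  assumes f: "f \<in> vcarrier (dual (space_of sX))"
  shows "rank_one f y \<in> compact_ops sX sY"
proof -
  let ?B = "vnorm (dual (space_of sX)) f"
  have "bounded_linear (\<lambda>c. sY c y)"
  proof (rule bounded_linear_intro)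
    show "sY (r *\<^sub>R c) y = r *\<^sub>R sY c y" for r c
      by (simp add: scaleR_conv_of_real flip: Y.scale_scale Y.scale_of_real)
  qed (auto simp: Y.scale_left_distrib Y.norm_scale)
  then have comp: "compact ((\<lambda>c. sY c y) ` cball 0 ?B)"
    by (intro compact_continuous_image linear_continuous_on compact_cball)
  have "norm (f v) \<le> ?B" if "norm v \<le> 1" for v
    using NX.dual_norm_bound[OF f, of v] mult_left_mono[OF that NX.dual_norm_nonneg[OF f]] by simp
  then have "rank_one f y ` cball 0 1 \<subseteq> (\<lambda>c. sY c y) ` cball 0 ?B"
    by (auto simp: rank_one_def)
  then have "closure (rank_one f y ` cball 0 1) \<subseteq> (\<lambda>c. sY c y) ` cball 0 ?B"
    by (intro closure_minimal compact_imp_closed comp)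
  then have "compact (closure (rank_one f y ` cball 0 1))"
    using compact_Int_closed[OF comp closed_closure] by (metis Int_absorb1)
  then show ?thesis using rank_one_mem[OF f] by (simp add: compact_ops_def)
qed

lemma bounded_map_eval: "bounded_map L (space_of sY) (norm x) (\<lambda>S. S x)"
  unfolding bounded_map_def using L_bound by (auto simp: mult.commute)

text \<open>
  The functional \<open>x \<otimes> g\<close>.  As the adjoint of evaluation at \<open>x\<close>, it inherits membership in the
  dual and its norm bound from \<open>bounded_map_dual_map\<close>.
\<close>

definition tensor :: "'a \<Rightarrow> ('b \<Rightarrow> 'k) \<Rightarrow> ('a \<Rightarrow> 'b) \<Rightarrow> 'k" where
  "tensor x g = dual_map L (\<lambda>S. S x) g"

lemma tensor_apply: "S \<in> vcarrier L \<Longrightarrow> tensor x g S = g (S x)"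
  by (simp add: tensor_def dual_map_def)

lemma tensor_mem: "g \<in> vcarrier (dual (space_of sY)) \<Longrightarrow> tensor x g \<in> vcarrier (dual L)"
  and tensor_norm_le: "g \<in> vcarrier (dual (space_of sY)) \<Longrightarrow>
    vnorm (dual L) (tensor x g) \<le> norm x * vnorm (dual (space_of sY)) g"
  using bounded_mapD(2,3)[OF bounded_map_dual_map[OF NL.normed_nspace_axioms NY.normed_nspace_axioms bounded_map_eval]]
  by (auto simp: tensor_def)

lemma tensor_rank_one:
  assumes "k \<in> vcarrier (dual (space_of sX))" "g \<in> vcarrier (dual (space_of sY))"
  shows "tensor x g (rank_one k y) = k x * g y"
  using NY.dual_scale[OF assms(2), of y] by (simp add: tensor_apply rank_one_mem[OF assms(1)])
    (simp add: rank_one_def)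

section \<open>The projection of an M-ideal of compact operators\<close>

definition M_projection :: "((('a \<Rightarrow> 'b) \<Rightarrow> 'k) \<Rightarrow> (('a \<Rightarrow> 'b) \<Rightarrow> 'k)) \<Rightarrow> bool" where
  "M_projection P \<longleftrightarrow> linear_projection (dual L) P \<and>
        (\<forall>f\<in>vcarrier (dual L). vnorm (dual L) (P f) + vnorm (dual L) (f - P f) = vnorm (dual L) f) \<and>
        {f \<in> vcarrier (dual L). P f = 0} = annihilator L (compact_ops sX sY)"

sublocale NDL: normed_nspace "dual L" by (rule NL.normed_nspace_dual)

lemma M_projection_add:
  assumes "M_projection P" "f \<in> vcarrier (dual L)" "g \<in> vcarrier (dual L)"
  shows "P (f + g) = P f + P g"
  using assms unfolding M_projection_def linear_projection_def by blast

lemma M_projectionD: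
  assumes P: "M_projection P" and f: "f \<in> vcarrier (dual L)"
  shows M_projection_mem: "P f \<in> vcarrier (dual L)"
    and M_projection_norm: "vnorm (dual L) (P f) + vnorm (dual L) (f - P f) = vnorm (dual L) f"
    and M_projection_compact: "S \<in> compact_ops sX sY \<Longrightarrow> P f S = f S"
    and M_projection_annihilator: "(\<And>S. S \<in> compact_ops sX sY \<Longrightarrow> f S = 0) \<Longrightarrow> P f = 0"
proof -
  show mem: "P f \<in> vcarrier (dual L)"
    and "vnorm (dual L) (P f) + vnorm (dual L) (f - P f) = vnorm (dual L) f"
    using P f by (auto simp: M_projection_def linear_projection_def)
  show "P f = 0" if "\<And>S. S \<in> compact_ops sX sY \<Longrightarrow> f S = 0"
    using P f that by (auto simp: M_projection_def annihilator_def)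
  show "P f S = f S" if "S \<in> compact_ops sX sY"
  proof -
    have d: "f - P f \<in> vcarrier (dual L)" using f mem by simp
    have "P ((f - P f) + P f) = P (f - P f) + P (P f)"
      using M_projection_add[OF P d mem] .
    then have "P (f - P f) = 0"
      using P f by (simp add: M_projection_def linear_projection_def)
    then have "f - P f \<in> annihilator L (compact_ops sX sY)"
      using P d by (auto simp: M_projection_def)
    then show ?thesis using that by (simp add: annihilator_def)
  qed
qed

lemma M_projection_bounded_map:
  assumes P: "M_projection P"
  shows "bounded_map (dual L) (dual L) 1 P"
proof -
  have "vnorm (dual L) (P f) \<le> vnorm (dual L) f" if f: "f \<in> vcarrier (dual L)" for f
    using M_projection_norm[OF P f] NL.dual_norm_nonneg[of "f - P f"] M_projection_mem[OF P f] f
    by simp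
  then show ?thesis
    using P unfolding bounded_map_def M_projection_def linear_projection_def by auto
qed

text \<open>
  The range of \<open>P\<close> meets its kernel, the annihilator of the compact operators, only in \<open>0\<close>.
\<close>

lemma M_projection_determined:
  assumes P: "M_projection P" and f: "f \<in> vcarrier (dual L)" "P f = f"
    and g: "g \<in> vcarrier (dual L)" "P g = g"
    and eq: "\<And>S. S \<in> compact_ops sX sY \<Longrightarrow> f S = g S"
  shows "f = g"
proof -
  have "P (f - g) = 0"
    using f g eq by (intro M_projection_annihilator[OF P]) auto
  moreover have "P ((f - g) + g) = P (f - g) + P g"
    using f g by (intro M_projection_add[OF P]) auto
  ultimately show ?thesis using f g by simp
qed

text \<open>
  Since \<open>P\<close> does not change values on compact operators, and the rank one operators \<open>k \<otimes> y\<close> with \<open>k\<close>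
  norming at \<open>x\<close> already witness the norm of \<open>x \<otimes> g\<close>, the image of \<open>x \<otimes> g\<close> has at least the norm of
  \<open>x \<otimes> g\<close>.  The norm identity then leaves nothing for the complementary part.
\<close>

lemma M_projection_tensor:
  assumes P: "M_projection P" and g: "g \<in> vcarrier (dual (space_of sY))"
  shows "P (tensor x g) = tensor x g"
proof -
  let ?t = "tensor x g" and ?n = "vnorm (dual L) (P (tensor x g))"
  note t = tensor_mem[OF g, of x]
  note Pt = M_projection_mem[OF P t]
  obtain f where f: "f \<in> vcarrier (dual (space_of sX))" "vnorm (dual (space_of sX)) f \<le> 1"
    "f x = of_real (norm x)"
    using NX.exists_norming_functional[of x] by auto
  have "norm x * norm (g y) \<le> ?n * norm y" for y
  proof -
    have "P ?t (rank_one f y) = of_real (norm x) * g y"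
      using M_projection_compact[OF P t rank_one_compact[OF f(1)], of y] f(3)
      by (simp add: tensor_rank_one[OF f(1) g])
    then have "norm x * norm (g y) \<le> ?n * onorm (rank_one f y)"
      using NL.dual_norm_bound[OF Pt rank_one_mem[OF f(1)], of y] by (simp add: norm_mult)
    also have "onorm (rank_one f y) \<le> 1 * norm y"
      using onorm_rank_one_le[OF f(1), of y] mult_right_mono[OF f(2), of "norm y"] by simp
    finally show ?thesis using NL.dual_norm_nonneg[OF Pt] by (simp add: mult_left_mono)
  qed
  then have "norm x * vnorm (dual (space_of sY)) g \<le> ?n"
  proof (cases "x = 0")
    case True
    then show ?thesis using NL.dual_norm_nonneg[OF Pt] by simp
  next
    case False
    assume *: "\<And>y. norm x * norm (g y) \<le> ?n * norm y"
    have "vnorm (dual (space_of sY)) g \<le> ?n / norm x"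
      using * False NL.dual_norm_nonneg[OF Pt]
      by (intro NY.dual_norm_le) (auto simp: field_simps)
    then show ?thesis using False by (simp add: field_simps)
  qed
  then have "vnorm (dual L) (?t - P ?t) \<le> 0"
    using M_projection_norm[OF P t] tensor_norm_le[OF g, of x] by simp
  then have "?t - P ?t = 0"
    using NL.dual_norm_nonneg[of "?t - P ?t"] NDL.norm_eq_zero[of "?t - P ?t"] t Pt by simp
  then show ?thesis by simp
qed

section \<open>Norming functionals of very smooth operators\<close>

lemma almost_norming_tensors:
  assumes T: "T \<in> vcarrier L" and norm: "onorm T = 1"
  shows "\<exists>x g. (\<forall>n::nat. norm (x n) \<le> 1 \<and> g n \<in> vcarrier (dual (space_of sY)) \<and>
    vnorm (dual (space_of sY)) (g n) \<le> 1) \<and> (\<lambda>n. g n (T (x n))) \<longlonglongrightarrow> 1"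
proof -
  have "\<exists>x g. norm x \<le> 1 \<and> g \<in> vcarrier (dual (space_of sY)) \<and> vnorm (dual (space_of sY)) g \<le> 1 \<and>
      g (T x) = of_real (norm (T x)) \<and> 1 - inverse (real (Suc n)) < norm (T x)" for n
  proof -
    let ?b = "1 - inverse (real (Suc n))"
    have "\<exists>x. norm x \<le> 1 \<and> ?b < norm (T x)"
    proof (rule ccontr)
      assume "\<not> ?thesis"
      then have *: "norm (T x) \<le> ?b" if "norm x \<le> 1" for x using that by (meson not_le)
      interpret T: bounded_linear T by (rule L_bounded[OF T])
      have "onorm T \<le> ?b"
      proof (rule onorm_bound)
        show "0 \<le> ?b" by (simp add: field_simps)
        show "norm (T x) \<le> ?b * norm x" for x
        proof (cases "x = 0")
          case True
          then show ?thesis by (simp add: T.zero)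
        next
          case False
          then have "norm (T (x /\<^sub>R norm x)) \<le> ?b" by (intro *) simp
          then show ?thesis using False by (simp add: T.scaleR divide_le_eq flip: divide_inverse_commute)
        qed
      qed
      with norm show False by (simp add: field_simps)
    qed
    then obtain x where "norm x \<le> 1" "?b < norm (T x)" by blast
    moreover obtain g where "g \<in> vcarrier (dual (space_of sY))" "vnorm (dual (space_of sY)) g \<le> 1"
      "g (T x) = of_real (norm (T x))"
      using NY.exists_norming_functional[of "T x"] by auto
    ultimately show ?thesis by blast
  qed
  then obtain x g where xg: "\<And>n. norm (x n) \<le> 1" "\<And>n. g n \<in> vcarrier (dual (space_of sY))"
    "\<And>n. vnorm (dual (space_of sY)) (g n) \<le> 1" "\<And>n. g n (T (x n)) = of_real (norm (T (x n)))"
    "\<And>n. 1 - inverse (real (Suc n)) < norm (T (x n))"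
    by metis
  have "(\<lambda>n. norm (T (x n))) \<longlonglongrightarrow> 1"
  proof (rule tendsto_sandwich)
    show "(\<lambda>n. 1 - inverse (real (Suc n))) \<longlonglongrightarrow> 1"
      using tendsto_diff[OF tendsto_const LIMSEQ_inverse_real_of_nat, of 1] by simp
    have "norm (T (x n)) \<le> 1" for n
      using L_bound[OF T, of "x n"] xg(1)[of n] norm by simp
    then show "\<forall>\<^sub>F n in sequentially. norm (T (x n)) \<le> 1" by simp
  qed (use xg(5) in \<open>auto intro!: always_eventually less_imp_le\<close>)
  then have "(\<lambda>n. g n (T (x n))) \<longlonglongrightarrow> 1"
    using tendsto_of_real[of _ 1, where ?'a = 'k] by (simp add: xg(4))
  with xg(1-3) show ?thesis by blast
qed

text \<open>
  Weak convergence of \<open>x\<^sub>n \<otimes> g\<^sub>n\<close> to \<open>f\<close> shows both that \<open>P\<close> fixes \<open>f\<close> and that the limit of \<open>x\<^sub>n\<close>, a priori an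
  element of \<open>X\<^sup>*\<^sup>*\<close>, lies in \<open>X\<close>.
\<close>

lemma norming_functional_is_tensor:
  assumes P: "M_projection P" and vs: "very_smooth_point L T"
    and f: "f \<in> vcarrier (dual L)" "vnorm (dual L) f \<le> 1" "f T = 1"
  obtains x0 \<eta> where "norm x0 \<le> 1" "\<eta> \<in> vcarrier (dual (space_of sY))"
    "vnorm (dual (space_of sY)) \<eta> \<le> 1" "f = tensor x0 \<eta>"
proof -
  let ?X = "space_of sX" and ?Y = "space_of sY"
  interpret DX: normed_nspace "dual ?X" by (rule NX.normed_nspace_dual)
  interpret DDX: normed_nspace "dual (dual ?X)" by (rule DX.normed_nspace_dual)
  have T: "T \<in> vcarrier L" "onorm T = 1" using vs by (auto simp: very_smooth_point_def)
  obtain x g where x: "\<And>n::nat. norm (x n) \<le> 1" and g: "\<And>n. g n \<in> vcarrier (dual ?Y)"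
      "\<And>n. vnorm (dual ?Y) (g n) \<le> 1" and gT: "(\<lambda>n. g n (T (x n))) \<longlonglongrightarrow> 1"
    using almost_norming_tensors[OF T] by blast
  obtain G :: "nat filter" where G: "ultrafilter G" "G \<le> sequentially"
    using ultrafilter_below[of sequentially] by auto
  have nb: "G \<noteq> bot" using G(1) by (simp add: ultrafilter_def)
  let ?\<phi> = "\<lambda>n. tensor (x n) (g n)"
  have \<phi>: "?\<phi> n \<in> vcarrier (dual L)" "vnorm (dual L) (?\<phi> n) \<le> 1" for n
  proof -
    show "?\<phi> n \<in> vcarrier (dual L)" by (rule tensor_mem[OF g(1)])
    show "vnorm (dual L) (?\<phi> n) \<le> 1"
      using tensor_norm_le[OF g(1), of "x n" n]
        mult_le_one[OF x[of n] NY.dual_norm_nonneg[OF g(1)] g(2), of n] by linarith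
  qed
  have "((\<lambda>n. ?\<phi> n T) \<longlongrightarrow> 1) G"
    using filterlim_mono[OF gT order_refl G(2)] by (simp add: tensor_apply T)
  then have weak: "((\<lambda>n. \<Psi> (?\<phi> n)) \<longlongrightarrow> \<Psi> f) G" if "\<Psi> \<in> vcarrier (dual (dual L))" for \<Psi>
    by (rule NL.very_smooth_weak_convergence[OF vs G(1) \<phi> _ f that])
  have lim: "((\<lambda>n. g n (S (x n))) \<longlongrightarrow> f S) G" if "S \<in> vcarrier L" for S
    using weak[OF NL.canonical_embedding_mem[OF that]] that
    by (simp add: NL.canonical_embedding_apply \<phi> f tensor_apply)
  \<comment> \<open>evaluation at \<open>S\<close> after \<open>P\<close> is weakly continuous, and \<open>P\<close> fixes each tensor\<close>
  have Pf: "P f = f"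
  proof (rule NL.functionals_eq)
    fix S assume S: "S \<in> vcarrier L"
    let ?\<Psi> = "dual_map (dual L) P (canonical_embedding L S)"
    have "?\<Psi> \<in> vcarrier (dual (dual L))"
      by (rule bounded_mapD(2)[OF bounded_map_dual_map[OF NDL.normed_nspace_axioms
          NDL.normed_nspace_axioms M_projection_bounded_map[OF P]] NL.canonical_embedding_mem[OF S]])
    from weak[OF this] have "((\<lambda>n. ?\<phi> n S) \<longlongrightarrow> P f S) G"
      using \<phi> f M_projection_mem[OF P]
      by (simp add: dual_map_def NL.canonical_embedding_apply M_projection_tensor[OF P g(1)])
    then show "P f S = f S"
      using tendsto_unique[OF nb _ lim[OF S]] S by (simp add: tensor_apply)
  qed (use f M_projection_mem[OF P] in auto)
  obtain \<eta> where \<eta>: "\<eta> \<in> vcarrier (dual ?Y)" "vnorm (dual ?Y) \<eta> \<le> 1"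
    "\<And>y. ((\<lambda>n. g n y) \<longlongrightarrow> \<eta> y) G"
    using NY.alaoglu_ultrafilter[OF G(1), of g, OF g] by auto
  \<comment> \<open>the \<open>g n\<close> are equicontinuous, so their pointwise limit may be taken along the norm convergent \<open>S (x n)\<close>\<close>
  have comp: "\<exists>c. ((\<lambda>n. S (x n)) \<longlongrightarrow> c) G \<and> f S = \<eta> c" if S: "S \<in> compact_ops sX sY" for S
  proof -
    have SL: "S \<in> vcarrier L" and cpt: "compact (closure (S ` cball 0 1))"
      using S by (auto simp: compact_ops_def)
    have "S (x n) \<in> closure (S ` cball 0 1)" for n
      using x[of n] closure_subset[of "S ` cball 0 1"] by auto
    then obtain c where c: "((\<lambda>n. S (x n)) \<longlongrightarrow> c) G"
      using ultrafilter_tendsto_compact[OF G(1) cpt, of "\<lambda>n. S (x n)"] by blast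
    have "((\<lambda>n. g n (S (x n)) - g n c) \<longlongrightarrow> 0) G"
    proof (rule Lim_null_comparison)
      have "norm (g n (S (x n)) - g n c) \<le> norm (S (x n) - c)" for n
        using NY.dual_norm_bound[OF g(1), of "S (x n) - c" n] NY.dual_diff[OF g(1), of "S (x n)" c n]
          mult_right_mono[OF g(2)[of n], of "norm (S (x n) - c)"] by simp
      then show "\<forall>\<^sub>F n in G. norm (g n (S (x n)) - g n c) \<le> norm (S (x n) - c)" by simp
      show "((\<lambda>n. norm (S (x n) - c)) \<longlongrightarrow> 0) G"
        using c by (simp add: LIM_zero_iff tendsto_norm_zero)
    qed
    from tendsto_add[OF this \<eta>(3)[of c]] have "((\<lambda>n. g n (S (x n))) \<longlongrightarrow> \<eta> c) G" by simp
    with c tendsto_unique[OF nb lim[OF SL]] show ?thesis by blast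
  qed
  obtain y1 where y1: "\<eta> y1 = 1"
  proof (cases "\<exists>y. \<eta> y \<noteq> 0")
    case True
    then obtain y where "\<eta> y \<noteq> 0" by blast
    then have "\<eta> (sY (inverse (\<eta> y)) y) = 1" using NY.dual_scale[OF \<eta>(1), of y] by simp
    then show ?thesis by (rule that)
  next
    case False
    then have "P f = 0"
      using comp by (intro M_projection_annihilator[OF P f(1)]) metis
    then show ?thesis using Pf f(3) by simp
  qed
  \<comment> \<open>\<open>?R f\<close> is the limit of \<open>x n\<close> in the bidual, as \<open>g n y1\<close> tends to \<open>\<eta> y1 = 1\<close>\<close>
  let ?r = "\<lambda>h. rank_one h y1"
  let ?R = "dual_map (dual ?X) ?r"
  note R = bounded_map_dual_map[OF DX.normed_nspace_axioms NL.normed_nspace_axioms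
      bounded_map_rank_one_left[of y1]]
  have R_\<phi>: "?R (?\<phi> n) = canonical_embedding ?X (sX (g n y1) (x n))" for n
    using NX.dual_scale[of _ "x n" "g n y1"]
    by (auto simp: dual_map_def fun_eq_iff canonical_embedding_def tensor_rank_one g(1) mult.commute)
  let ?J = "range (canonical_embedding ?X)"
  have ann: "\<Theta> (?R f) = 0" if \<Theta>: "\<Theta> \<in> vcarrier (dual (dual (dual ?X)))"
    and J: "\<And>z. z \<in> ?J \<Longrightarrow> \<Theta> z = 0" for \<Theta>
  proof -
    have "dual_map (dual L) ?R \<Theta> \<in> vcarrier (dual (dual L))"
      by (rule bounded_mapD(2)[OF bounded_map_dual_map[OF NDL.normed_nspace_axioms
          DDX.normed_nspace_axioms R] \<Theta>])
    from weak[OF this] have "((\<lambda>n. \<Theta> (?R (?\<phi> n))) \<longlongrightarrow> \<Theta> (?R f)) G"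
      using \<phi>(1) f(1) by (simp add: dual_map_def[of "dual L"])
    then have "((\<lambda>n. 0) \<longlongrightarrow> \<Theta> (?R f)) G" by (simp add: R_\<phi> J)
    then show ?thesis using tendsto_unique[OF nb _ tendsto_const] by blast
  qed
  have "\<exists>u. vnorm (dual (dual ?X)) (?R f - canonical_embedding ?X u) < e" if "0 < e" for e
  proof -
    have "\<exists>z\<in>?J. vnorm (dual (dual ?X)) (?R f - z) < e"
    proof (rule DDX.subspace_approximation[where M = ?J])
      show "?J \<subseteq> vcarrier (dual (dual ?X))" by (auto intro: NX.canonical_embedding_mem)
      have "canonical_embedding ?X 0 = 0"
        using NX.canonical_embedding_diff[of 0 0] by simp
      then show "0 \<in> ?J" by (metis rangeI)
      show "z + z' \<in> ?J" if "z \<in> ?J" "z' \<in> ?J" for z z'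
        using that NX.canonical_embedding_add by (metis (no_types, lifting) UNIV_I rangeE rangeI space_of_simps(1))
      show "vscale (dual (dual ?X)) c z \<in> ?J" if "z \<in> ?J" for c z
        using that NX.canonical_embedding_scale by (metis (no_types, lifting) UNIV_I rangeE rangeI space_of_simps(1))
      show "?R f \<in> vcarrier (dual (dual ?X))" by (rule bounded_mapD(2)[OF R f(1)])
      show "\<Theta> (?R f) = 0" if "\<Theta> \<in> vcarrier (dual (dual (dual ?X)))" "\<And>z. z \<in> ?J \<Longrightarrow> \<Theta> z = 0" for \<Theta>
        using that by (rule ann)
    qed (rule that)
    then show ?thesis by blast
  qed
  then obtain x0 where x0: "?R f = canonical_embedding ?X x0"
    using X.canonical_range_closed[OF bounded_mapD(2)[OF R f(1)]] by blast
  have weak_x: "((\<lambda>n. h (x n)) \<longlongrightarrow> h x0) G" if h: "h \<in> vcarrier (dual ?X)" for h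
  proof -
    have "f (rank_one h y1) = h x0"
      using fun_cong[OF x0, of h] h by (simp add: dual_map_def NX.canonical_embedding_apply)
    then have "((\<lambda>n. h (x n) * g n y1) \<longlongrightarrow> h x0) G"
      using lim[OF rank_one_mem[OF h, of y1]] NY.dual_scale[OF g(1), of y1]
      by (simp add: rank_one_def)
    from tendsto_divide[OF this \<eta>(3)[of y1]]
    have "((\<lambda>n. h (x n) * g n y1 / g n y1) \<longlongrightarrow> h x0) G" by (simp add: y1)
    moreover have "\<forall>\<^sub>F n in G. h (x n) * g n y1 / g n y1 = h (x n)"
    proof -
      have "\<forall>\<^sub>F n in G. g n y1 \<noteq> 0"
        using \<eta>(3)[of y1] y1 by (intro tendsto_imp_eventually_ne) auto
      then show ?thesis by eventually_elim simp
    qed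
    ultimately show ?thesis by (simp add: tendsto_cong)
  qed
  have "norm x0 \<le> 1"
  proof -
    obtain h where h: "h \<in> vcarrier (dual ?X)" "vnorm (dual ?X) h \<le> 1" "h x0 = of_real (norm x0)"
      using NX.exists_norming_functional[of x0] by auto
    have "norm (h (x n)) \<le> 1" for n
      using NX.dual_norm_bound[OF h(1), of "x n"] mult_le_one[OF h(2) norm_ge_zero x[of n]] by simp
    then have "norm (h x0) \<le> 1"
      by (intro tendsto_upperbound[OF tendsto_norm[OF weak_x[OF h(1)]] _ nb]) simp
    then show ?thesis using h(3) by simp
  qed
  moreover have "f = tensor x0 \<eta>"
  proof (rule M_projection_determined[OF P f(1) Pf tensor_mem[OF \<eta>(1)] M_projection_tensor[OF P \<eta>(1)]])
    fix S assume S: "S \<in> compact_ops sX sY"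
    then have SL: "S \<in> vcarrier L" by (simp add: compact_ops_def)
    obtain c where c: "((\<lambda>n. S (x n)) \<longlongrightarrow> c) G" "f S = \<eta> c" using comp[OF S] by blast
    \<comment> \<open>the norm limit of \<open>S (x n)\<close> agrees with its weak limit\<close>
    have "c = S x0"
    proof (rule NY.functionals_separate)
      fix h assume h: "h \<in> vcarrier (dual ?Y)"
      have "bounded_map ?X ?Y (onorm S) S"
        using bounded_opsD[OF SL] onorm_pos_le[OF L_bounded[OF SL]] by (auto simp: bounded_map_def)
      then have "dual_map ?X S h \<in> vcarrier (dual ?X)"
        by (rule bounded_mapD(2)[OF bounded_map_dual_map[OF NX.normed_nspace_axioms NY.normed_nspace_axioms] h])
      from weak_x[OF this] have 1: "((\<lambda>n. h (S (x n))) \<longlongrightarrow> h (S x0)) G" by (simp add: dual_map_def)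
      have "((\<lambda>n. h (S (x n)) - h c) \<longlongrightarrow> 0) G"
      proof (rule Lim_null_comparison)
        have "norm (h (S (x n)) - h c) \<le> vnorm (dual ?Y) h * norm (S (x n) - c)" for n
          using NY.dual_norm_bound[OF h, of "S (x n) - c"] NY.dual_diff[OF h, of "S (x n)" c] by simp
        then show "\<forall>\<^sub>F n in G. norm (h (S (x n)) - h c) \<le> vnorm (dual ?Y) h * norm (S (x n) - c)" by simp
        show "((\<lambda>n. vnorm (dual ?Y) h * norm (S (x n) - c)) \<longlongrightarrow> 0) G"
          using c(1) by (intro tendsto_mult_right_zero tendsto_norm_zero) (simp add: LIM_zero_iff)
      qed
      then have "((\<lambda>n. h (S (x n))) \<longlongrightarrow> h c) G" by (simp add: LIM_zero_iff)
      then show "h c = h (S x0)" using tendsto_unique[OF nb _ 1] by blast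
    qed auto
    then show "f S = tensor x0 \<eta> S" using c(2) by (simp add: tensor_apply SL)
  qed
  ultimately show ?thesis using \<eta> that by blast
qed

end

theorem corollary22:
  fixes sX :: "'k::real_or_complex \<Rightarrow> 'a::banach \<Rightarrow> 'a"
    and sY :: "'k \<Rightarrow> 'b::banach \<Rightarrow> 'b"
    and T :: "'a \<Rightarrow> 'b"
  assumes "banach_space_over sX" and "banach_space_over sY"
    and "M_ideal (bounded_ops sX sY) (compact_ops sX sY)"
    and "T \<in> vcarrier (bounded_ops sX sY)"
    and "very_smooth_point (bounded_ops sX sY) T"
  shows "\<exists>x. attains_norm_at T x \<and>
           (\<forall>x'. attains_norm_at T x' \<longrightarrow> (\<exists>c. x' = sX c x)) \<and>
           very_smooth_point (space_of sY) (T x)"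
proof -
  interpret operator_space sX sY
    using assms(1,2) by (simp add: operator_space_def)
  let ?X = "space_of sX" and ?Y = "space_of sY"
  note T = assms(4) and vs = assms(5)
  have T1: "onorm T = 1" using vs by (simp add: very_smooth_point_def)
  obtain P where P: "M_projection P"
    using assms(3) by (auto simp: M_ideal_def M_projection_def)
  obtain f where f: "f \<in> vcarrier (dual L)" "vnorm (dual L) f \<le> 1" "f T = 1"
    using NL.exists_norming_functional[OF T] T1 by auto
  obtain x \<eta> where x: "norm x \<le> 1" and \<eta>: "\<eta> \<in> vcarrier (dual ?Y)" "vnorm (dual ?Y) \<eta> \<le> 1"
    and fx: "f = tensor x \<eta>"
    using norming_functional_is_tensor[OF P vs f] .
  have \<eta>1: "\<eta> (T x) = 1" using f(3) fx T by (simp add: tensor_apply)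
  have "1 \<le> norm (T x)"
    using NY.dual_norm_bound[OF \<eta>(1), of "T x"] \<eta>1 mult_right_mono[OF \<eta>(2), of "norm (T x)"] by simp
  moreover have "norm (T x) \<le> norm x" using L_bound[OF T, of x] T1 by simp
  ultimately have nx: "norm x = 1" and nTx: "norm (T x) = 1" using x by auto
  have "\<exists>c. x' = sX c x" if "attains_norm_at T x'" for x'
  proof -
    have x': "norm x' = 1" "norm (T x') = 1" using that T1 by (auto simp: attains_norm_at_def)
    obtain h where h: "h \<in> vcarrier (dual ?Y)" "vnorm (dual ?Y) h \<le> 1" "h (T x') = 1"
      using NY.exists_norming_functional[of "T x'"] x' by auto
    \<comment> \<open>both are norming functionals of \<open>T\<close>\<close>
    have "tensor x' h = f"
    proof (rule NL.very_smooth_point_unique[OF vs _ _ _ f])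
      show "tensor x' h \<in> vcarrier (dual L)" by (rule tensor_mem[OF h(1)])
      show "vnorm (dual L) (tensor x' h) \<le> 1" using tensor_norm_le[OF h(1), of x'] h(2) x' by simp
      show "tensor x' h T = 1" using h(3) T by (simp add: tensor_apply)
    qed
    then have eq: "tensor x' h = tensor x \<eta>" using fx by simp
    have "x' = sX (\<eta> (T x')) x"
    proof (rule NX.functionals_separate)
      fix k assume k: "k \<in> vcarrier (dual ?X)"
      have "tensor x' h (rank_one k (T x')) = tensor x \<eta> (rank_one k (T x'))" using eq by simp
      then have "k x' = k x * \<eta> (T x')"
        by (simp add: tensor_rank_one[OF k] h \<eta>(1))
      then show "k x' = k (sX (\<eta> (T x')) x)" using NX.dual_scale[OF k, of x] by simp
    qed auto
    then show ?thesis ..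
  qed
  moreover have "very_smooth_point ?Y (T x)"
  proof -
    obtain k where k: "k \<in> vcarrier (dual ?X)" "k x = 1"
      using NX.exists_norming_functional[of x] nx by auto
    have e: "bounded_map L ?Y 1 (\<lambda>S. S x)" using bounded_map_eval[of x] nx by simp
    show ?thesis
      by (rule very_smooth_point_retract[OF NL.normed_nspace_axioms NY.normed_nspace_axioms e
          bounded_map_rank_one_right[OF k(1)] _ vs])
        (use k nTx in \<open>auto simp: rank_one_def\<close>)
  qed
  ultimately show ?thesis using nx nTx T1 by (auto simp: attains_norm_at_def)
qed

end
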